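(* Let $d\in\{2,3\}$, let $\Omega\subset\mathbb{R}^d$ be a bounded domain with smooth boundary, let $D(x)>0$ be a smoothly varying diffusivity on $\Omega$, and set $M(x)=1/D(x)$, $|M|=\int_\Omega M(x)\,dx$, $\mu(x)=M(x)/|M|$. Let $\kappa>0$. For a density $\rho$ on $\Omega$, let $u$ be the solution of $$\Delta u-\kappa\,\rho(x)\,u=-M(x)\ \text{ in }\Omega,\qquad \partial_n u=0\ \text{ on }\partial\Omega ,$$ and for a density $\omega$ on $\Omega$ define $\overline{u}_\omega[\rho]=\int_\Omega\omega(x)u(x)\,dx$. Then $$\overline{u}_\omega[\rho]\ \ge\ \frac{|M|}{\kappa}\left(\int_\Omega\sqrt{\omega(x)\mu(x)}\,dx\right)^2\qquad\text{for all densities }\omega,\rho\text{ and any }\kappa>0 .$$ Moreover, equality is achieved if and only if $\omega=\rho=\mu$.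
   Context: A density on $\Omega$ is a function $f\ge 0$ on $\Omega$ with $\int_\Omega f\,dx=1$; densities are identified when they agree almost everywhere. Here $\partial_n$ is the normal derivative on $\partial\Omega$. Interpretation: $u(x)$ is the homogenized mean first-passage time from $x$ of a Brownian particle with diffusivity $D(x)$ (Itô interpretation, reflecting boundary) to many small absorbing traps with spatial density $\rho$ and trapping strength $\kappa$; $\omega$ is the distribution of the starting point. *)

theory Defs
  imports "HOL-Analysis.Analysis"
begin

section \<open>Smooth functions and smooth bounded domains\<close>

text \<open>Only meant for open sets \<open>S\<close>: the partial derivatives are those of the total derivative.\<close>

fun Ck_on :: "nat \<Rightarrow> 'a::euclidean_space set \<Rightarrow> ('a \<Rightarrow> real) \<Rightarrow> bool" where
  "Ck_on 0 S f \<longleftrightarrow> continuous_on S f"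
| "Ck_on (Suc k) S f \<longleftrightarrow> f differentiable_on S \<and>
     (\<forall>b\<in>Basis. Ck_on k S (\<lambda>x. frechet_derivative f (at x) b))"

definition smooth_on :: "'a::euclidean_space set \<Rightarrow> ('a \<Rightarrow> real) \<Rightarrow> bool" where
  "smooth_on S f \<longleftrightarrow> (\<forall>k. Ck_on k S f)"

text \<open>Near each boundary point, \<open>\<Omega>\<close> is the sublevel set of a smooth local defining function
  without critical points; the boundary is then locally its zero set, and \<open>\<Omega>\<close> lies on one side.\<close>

definition smooth_boundary :: "'a::euclidean_space set \<Rightarrow> bool" where
  "smooth_boundary \<Omega> \<longleftrightarrow>
     (\<forall>p\<in>frontier \<Omega>. \<exists>U \<phi>. open U \<and> p \<in> U \<and> smooth_on U \<phi> \<and>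
        (\<forall>x\<in>U. \<exists>b\<in>Basis. frechet_derivative \<phi> (at x) b \<noteq> 0) \<and>
        \<Omega> \<inter> U = {x\<in>U. \<phi> x < 0})"

definition smooth_bounded_domain :: "'a::euclidean_space set \<Rightarrow> bool" where
  "smooth_bounded_domain \<Omega> \<longleftrightarrow>
     open \<Omega> \<and> connected \<Omega> \<and> \<Omega> \<noteq> {} \<and> bounded \<Omega> \<and> smooth_boundary \<Omega>"

definition density_on :: "'a::euclidean_space set \<Rightarrow> ('a \<Rightarrow> real) \<Rightarrow> bool" where
  "density_on \<Omega> f \<longleftrightarrow>
     integrable (lebesgue_on \<Omega>) f \<and> (\<forall>x\<in>\<Omega>. 0 \<le> f x) \<and> (\<integral>x. f x \<partial>lebesgue_on \<Omega>) = 1"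


section \<open>The Sobolev space H1 and weak solutions of the Neumann problem\<close>

definition test_function :: "'a::euclidean_space set \<Rightarrow> ('a \<Rightarrow> real) \<Rightarrow> bool" where
  "test_function \<Omega> \<phi> \<longleftrightarrow>
     smooth_on UNIV \<phi> \<and> compact (closure {x. \<phi> x \<noteq> 0}) \<and> closure {x. \<phi> x \<noteq> 0} \<subseteq> \<Omega>"

definition square_integrable_on ::
    "'a::euclidean_space set \<Rightarrow> ('a \<Rightarrow> 'b::euclidean_space) \<Rightarrow> bool" where
  "square_integrable_on \<Omega> f \<longleftrightarrow>
     f \<in> borel_measurable (lebesgue_on \<Omega>) \<and> integrable (lebesgue_on \<Omega>) (\<lambda>x. (norm (f x))\<^sup>2)"

text \<open>\<open>H1_on \<Omega> u g\<close>: the function \<open>u\<close> belongs to \<open>H\<^sup>1(\<Omega>)\<close> and has weak gradient \<open>g\<close>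
  (which is determined almost everywhere).\<close>

definition H1_on :: "'a::euclidean_space set \<Rightarrow> ('a \<Rightarrow> real) \<Rightarrow> ('a \<Rightarrow> 'a) \<Rightarrow> bool" where
  "H1_on \<Omega> u g \<longleftrightarrow>
     square_integrable_on \<Omega> u \<and> square_integrable_on \<Omega> g \<and>
     (\<forall>\<phi> b. test_function \<Omega> \<phi> \<longrightarrow> b \<in> Basis \<longrightarrow>
        (\<integral>x. u x * frechet_derivative \<phi> (at x) b \<partial>lebesgue_on \<Omega>) =
        - (\<integral>x. (g x \<bullet> b) * \<phi> x \<partial>lebesgue_on \<Omega>))"

text \<open>Weak form of \<open>\<Delta>u - \<kappa> \<rho> u = - M\<close> in \<open>\<Omega>\<close> with \<open>\<partial>\<^sub>n u = 0\<close> on the boundary. A density \<open>\<rho>\<close> is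
  merely integrable, so in general there is no classical solution. The equation is multiplied by
  \<open>v\<close> and integrated by parts; as \<open>v\<close> is not required to vanish on the boundary, the Neumann
  condition is encoded as the natural boundary condition. Since \<open>v\<close> is essentially bounded and
  \<open>\<rho> u\<close> and \<open>M\<close> are integrable, every integral below exists.\<close>

definition weak_neumann_solution ::
    "'a::euclidean_space set \<Rightarrow> real \<Rightarrow> ('a \<Rightarrow> real) \<Rightarrow> ('a \<Rightarrow> real) \<Rightarrow> ('a \<Rightarrow> real) \<Rightarrow> bool" where
  "weak_neumann_solution \<Omega> \<kappa> \<rho> M u \<longleftrightarrow>
     (\<exists>g. H1_on \<Omega> u g \<and> integrable (lebesgue_on \<Omega>) (\<lambda>x. \<rho> x * u x) \<and>
        (\<forall>v h. H1_on \<Omega> v h \<longrightarrow> (\<exists>C. AE x in lebesgue_on \<Omega>. \<bar>v x\<bar> \<le> C) \<longrightarrow>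
           (\<integral>x. g x \<bullet> h x \<partial>lebesgue_on \<Omega>) + \<kappa> * (\<integral>x. \<rho> x * u x * v x \<partial>lebesgue_on \<Omega>) =
           (\<integral>x. M x * v x \<partial>lebesgue_on \<Omega>)))"


section \<open>The averaged first-passage time\<close>

text \<open>The integral of \<open>\<omega> u\<close> over \<open>\<Omega>\<close> as an extended real, positive part minus negative part: the
  Bochner integral would have the value 0 if \<open>\<omega> u\<close> were not integrable.\<close>

definition mean_passage_time ::
    "'a::euclidean_space set \<Rightarrow> ('a \<Rightarrow> real) \<Rightarrow> ('a \<Rightarrow> real) \<Rightarrow> ereal" where
  "mean_passage_time \<Omega> \<omega> u =
     enn2ereal (\<integral>\<^sup>+x. ennreal (\<omega> x * u x) \<partial>lebesgue_on \<Omega>) -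
     enn2ereal (\<integral>\<^sup>+x. ennreal (- (\<omega> x * u x)) \<partial>lebesgue_on \<Omega>)"

lemma mean_passage_time_eq_integral:
  assumes "integrable (lebesgue_on \<Omega>) (\<lambda>x. \<omega> x * u x)"
  shows "mean_passage_time \<Omega> \<omega> u = ereal (\<integral>x. \<omega> x * u x \<partial>lebesgue_on \<Omega>)"
proof -
  obtain r q where "0 \<le> r" "0 \<le> q"
    "(\<integral>\<^sup>+x. ennreal (\<omega> x * u x) \<partial>lebesgue_on \<Omega>) = ennreal r"
    "(\<integral>\<^sup>+x. ennreal (- (\<omega> x * u x)) \<partial>lebesgue_on \<Omega>) = ennreal q"
    "(\<integral>x. \<omega> x * u x \<partial>lebesgue_on \<Omega>) = r - q"
    using assms by (rule integrableE)
  then show ?thesis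
    by (simp add: mean_passage_time_def)
qed

end

(*
  Testing the equation with 1/u turns the diffusion term into minus the integral of |grad u|^2/u^2,
  so the integral of M/u is at most kappa, with equality only if grad u = 0. By Cauchy-Schwarz the
  square of the integral of sqrt(omega M) is at most the product of the integrals of omega u and
  M/u, which is the bound. In the equality case grad u = 0, so u is constant because Omega is
  connected; the equation then reads rho = mu, and the integral of sqrt(omega mu) equals 1, which
  forces omega = mu.

  As u is only a weak solution, 1/u is replaced by 1/sqrt(d + u^2) with d -> 0, after a truncation of
  the negative part has shown u >= 0. That these compositions lie in H1 is proved by mollification.
*)
theory Submission
  imports Defs "HOL-Computational_Algebra.Polynomial"
begin

section \<open>Smooth functions and bumps\<close>

text \<open>Since \<rho> is merely integrable, the weak equation admits only essentially bounded
  test functions, and u itself need not be bounded. Every test function built from u is therefore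
  \<open>F (u x)\<close> with F of class C1 and both F and F' bounded; this decides the shape of
  \<open>neg_cutoff\<close> and of \<open>1 / sqrt (d + s\<^sup>2)\<close>. The equality case is the
  delicate point, since a strict defect could be lost as d \<rightarrow> 0. Hence a part of the
  gradient term that does not depend on d is carried through the estimates as the number
  \<open>dissipation\<close>. It ends up as an explicit surplus in the final inequality, and
  equality forces it to be 0. Weak derivatives are tested only with functions of compact support in
  \<Omega>, so mollification at a small radius never sees the boundary; the Neumann condition enters
  only through the freedom of the test functions in the weak equation. The integral of \<omega> u
  may be infinite. The inequality is then trivial, but it remains to show that \<omega> = \<rho> =
  \<mu> cannot occur.\<close>

definition flat :: "real poly \<Rightarrow> real \<Rightarrow> real" where
  "flat p t = (if t > 0 then poly p (1 / t) * exp (- (1 / t)) else 0)"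

lemma poly_div_exp_tendsto_0:
  fixes p :: "real poly"
  shows "((\<lambda>x. poly p x / exp x) \<longlongrightarrow> 0) at_top"
proof -
  have "((\<lambda>x. \<Sum>i\<le>degree p. coeff p i * (x ^ i / exp x)) \<longlongrightarrow> (\<Sum>i\<le>degree p. coeff p i * 0)) at_top"
    by (intro tendsto_sum tendsto_mult tendsto_const tendsto_power_div_exp_0)
  then show ?thesis
    by (simp add: poly_altdef sum_divide_distrib)
qed

text \<open>With s = 1/t one has d/dt = - s^2 d/ds, so p(s) exp(-s) turns into s^2 (p - p')(s)
  exp(-s). The family is thus closed under differentiation, and \<open>[:0, 0, 1:]\<close> is the
  factor s^2. At t = 0 the difference quotient tends to 0 because the exponential beats every
  polynomial.\<close>

lemma flat_has_real_derivative:
  "(flat p has_real_derivative flat ([:0, 0, 1:] * (p - pderiv p)) t) (at t)"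
proof -
  consider "t < 0" | "t = 0" | "t > 0" by linarith
  then show ?thesis
  proof cases
    case 1
    have "((\<lambda>_. 0) has_real_derivative 0) (at t)" by simp
    then have "(flat p has_real_derivative 0) (at t)"
      by (rule DERIV_cong_ev[OF refl _ refl, THEN iffD1, rotated])
         (use 1 in \<open>auto simp: flat_def eventually_nhds intro!: exI[of _ "{..<0}"]\<close>)
    then show ?thesis using 1 by (simp add: flat_def)
  next
    case 2
    have "((\<lambda>h. flat p h / h) \<longlongrightarrow> 0) (at_left 0)"
      by (rule tendsto_eventually) (auto simp: flat_def eventually_at_filter)
    moreover have "((\<lambda>h. flat p h / h) \<longlongrightarrow> 0) (at_right 0)"
    proof -
      \<comment> \<open>In the variable 1/h the difference quotient is a polynomial over the
        exponential; the extra \<open>[:0, 1:]\<close> is the 1/h of the quotient.\<close>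
      have "((\<lambda>h. poly ([:0, 1:] * p) (inverse h) / exp (inverse h)) \<longlongrightarrow> 0) (at_right (0::real))"
        by (rule filterlim_compose[OF poly_div_exp_tendsto_0 filterlim_inverse_at_top_right])
      moreover have "\<forall>\<^sub>F h in at_right 0. poly ([:0, 1:] * p) (inverse h) / exp (inverse h) = flat p h / h"
        by (auto simp: flat_def eventually_at_filter exp_minus field_simps)
      ultimately show ?thesis by (rule Lim_transform_eventually)
    qed
    ultimately have "((\<lambda>h. flat p h / h) \<longlongrightarrow> 0) (at 0)"
      by (simp add: filterlim_at_split)
    then show ?thesis
      using 2 by (simp add: DERIV_def flat_def)
  next
    case 3
    have "((\<lambda>t. poly p (1 / t) * exp (- (1 / t))) has_real_derivative
        flat ([:0, 0, 1:] * (p - pderiv p)) t) (at t)"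
      using 3 by (auto intro!: derivative_eq_intros simp: flat_def field_simps power2_eq_square)
    then show ?thesis
      by (rule DERIV_cong_ev[OF refl _ refl, THEN iffD1, rotated])
         (use 3 in \<open>auto simp: flat_def eventually_nhds intro!: exI[of _ "{0<..}"]\<close>)
  qed
qed

text \<open>This algebra of functions is closed under directional derivatives, so all its members are smooth.
  That avoids a chain rule for \<open>smooth_on\<close>.\<close>

inductive smooth_alg :: "real \<Rightarrow> 'a::euclidean_space \<Rightarrow> ('a \<Rightarrow> real) \<Rightarrow> bool" for r a where
  const: "smooth_alg r a (\<lambda>x. c)"
| coord: "smooth_alg r a (\<lambda>x. x \<bullet> b)"
| flat: "smooth_alg r a (\<lambda>x. flat p (r\<^sup>2 - (x - a) \<bullet> (x - a)))"
| add: "smooth_alg r a f \<Longrightarrow> smooth_alg r a g \<Longrightarrow> smooth_alg r a (\<lambda>x. f x + g x)"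
| mult: "smooth_alg r a f \<Longrightarrow> smooth_alg r a g \<Longrightarrow> smooth_alg r a (\<lambda>x. f x * g x)"

lemma smooth_alg_derivative:
  assumes "smooth_alg r a f"
  shows "\<exists>f'. (\<forall>x. (f has_derivative f' x) (at x)) \<and> (\<forall>h. smooth_alg r a (\<lambda>x. f' x h))"
  using assms
proof induction
  case (const c)
  show ?case
    by (intro exI[of _ "\<lambda>_ _. 0"]) (auto intro: smooth_alg.const)
next
  case (coord b)
  show ?case
    by (intro exI[of _ "\<lambda>_ h. h \<bullet> b"])
      (auto intro: smooth_alg.const intro!: derivative_eq_intros)
next
  case (flat p)
  define q where "q = [:0, 0, 1:] * (p - pderiv p)"
  have "((\<lambda>x. flat p (r\<^sup>2 - (x - a) \<bullet> (x - a))) has_derivative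
      (\<lambda>h. flat q (r\<^sup>2 - (x - a) \<bullet> (x - a)) * (- 2 * (x \<bullet> h) + 2 * (a \<bullet> h)))) (at x)" for x
  proof -
    have "((\<lambda>x. r\<^sup>2 - (x - a) \<bullet> (x - a)) has_derivative (\<lambda>h. - 2 * (x \<bullet> h) + 2 * (a \<bullet> h))) (at x)"
      by (auto intro!: derivative_eq_intros simp: algebra_simps inner_commute)
    from has_derivative_compose[OF this
        flat_has_real_derivative[of p, folded q_def, unfolded has_field_derivative_def]]
    show ?thesis by simp
  qed
  moreover have "smooth_alg r a (\<lambda>x. flat q (r\<^sup>2 - (x - a) \<bullet> (x - a)) * (- 2 * (x \<bullet> h) + 2 * (a \<bullet> h)))" for h
    by (intro smooth_alg.intros)
  ultimately show ?case
    by (intro exI[of _ "\<lambda>x h. flat q (r\<^sup>2 - (x - a) \<bullet> (x - a)) * (- 2 * (x \<bullet> h) + 2 * (a \<bullet> h))"]) blast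
next
  case (add f g)
  then obtain f' g' where "\<And>x. (f has_derivative f' x) (at x)" "\<And>h. smooth_alg r a (\<lambda>x. f' x h)"
    "\<And>x. (g has_derivative g' x) (at x)" "\<And>h. smooth_alg r a (\<lambda>x. g' x h)"
    by blast
  then show ?case
    by (intro exI[of _ "\<lambda>x h. f' x h + g' x h"]) (auto intro: smooth_alg.intros has_derivative_add)
next
  case (mult f g)
  then obtain f' g' where "\<And>x. (f has_derivative f' x) (at x)" "\<And>h. smooth_alg r a (\<lambda>x. f' x h)"
    "\<And>x. (g has_derivative g' x) (at x)" "\<And>h. smooth_alg r a (\<lambda>x. g' x h)"
    by blast
  with mult.hyps show ?case
    by (intro exI[of _ "\<lambda>x h. f x * g' x h + f' x h * g x"])
      (auto intro!: smooth_alg.intros has_derivative_mult)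
qed

lemma smooth_alg_smooth_on:
  assumes "smooth_alg r a f"
  shows "smooth_on UNIV f"
proof -
  have "Ck_on k UNIV f" for k
    using assms
  proof (induction k arbitrary: f)
    case 0
    then show ?case
      using smooth_alg_derivative[OF 0]
      by (auto simp: continuous_on_eq_continuous_within intro: has_derivative_continuous)
  next
    case (Suc k)
    obtain f' where f': "\<And>x. (f has_derivative f' x) (at x)" "\<And>h. smooth_alg r a (\<lambda>x. f' x h)"
      using smooth_alg_derivative[OF Suc.prems] by blast
    have "f' x = frechet_derivative f (at x)" for x
      using f'(1) by (rule frechet_derivative_at)
    then show ?case
      using f' Suc.IH by (auto simp: differentiable_on_def differentiable_def)
  qed
  then show ?thesis by (simp add: smooth_on_def)
qed

section \<open>Smooth functions on the whole space and compact support\<close>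

lemma smooth_on_UNIV_has_derivative:
  assumes "smooth_on UNIV f"
  shows "(f has_derivative frechet_derivative f (at x)) (at x)"
proof -
  have "Ck_on (Suc 0) UNIV f" using assms by (simp only: smooth_on_def)
  then have "f differentiable (at x)" by (simp add: differentiable_on_def)
  then show ?thesis by (simp add: frechet_derivative_works)
qed

lemma smooth_on_UNIV_continuous:
  assumes "smooth_on UNIV f"
  shows "continuous_on UNIV f"
  by (metis assms Ck_on.simps(1) smooth_on_def)

text \<open>\<open>Ck_on\<close> speaks about basis directions only; this expansion carries
  continuity and bounds over to an arbitrary direction h.\<close>

lemma smooth_on_UNIV_derivative_inner:
  assumes "smooth_on UNIV (f :: 'a::euclidean_space \<Rightarrow> real)"
  shows "frechet_derivative f (at x) h = (\<Sum>b\<in>Basis. (h \<bullet> b) * frechet_derivative f (at x) b)"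
proof -
  interpret linear "frechet_derivative f (at x)"
    using smooth_on_UNIV_has_derivative[OF assms] by (rule has_derivative_linear)
  have "frechet_derivative f (at x) h = frechet_derivative f (at x) (\<Sum>b\<in>Basis. (h \<bullet> b) *\<^sub>R b)"
    by (simp add: euclidean_representation)
  then show ?thesis by (simp add: sum scale)
qed

lemma smooth_on_UNIV_derivative_continuous:
  assumes "smooth_on UNIV (f :: 'a::euclidean_space \<Rightarrow> real)"
  shows "continuous_on UNIV (\<lambda>x. frechet_derivative f (at x) h)"
proof -
  have "Ck_on (Suc 0) UNIV f" using assms by (simp only: smooth_on_def)
  then have "\<forall>b\<in>Basis. continuous_on UNIV (\<lambda>x. frechet_derivative f (at x) b)" by simp
  then show ?thesis
    by (subst smooth_on_UNIV_derivative_inner[OF assms]) (auto intro!: continuous_intros)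
qed

lemma frechet_derivative_zero_outside_support:
  fixes f :: "'a::real_normed_vector \<Rightarrow> real"
  assumes "x \<notin> closure {x. f x \<noteq> 0}"
  shows "frechet_derivative f (at x) = (\<lambda>h. 0)"
proof -
  have "((\<lambda>_. 0) has_derivative (\<lambda>_. 0)) (at x)" by simp
  then have "(f has_derivative (\<lambda>_. 0)) (at x)"
  proof (rule has_derivative_transform_within_open)
    show "open (- closure {x. f x \<noteq> 0})" by auto
    show "x \<in> - closure {x. f x \<noteq> 0}" using assms by auto
    show "0 = f y" if "y \<in> - closure {x. f x \<noteq> 0}" for y
      using that closure_subset[of "{x. f x \<noteq> 0}"] by auto
  qed
  then show ?thesis by (metis frechet_derivative_at)
qed

lemma smooth_compact_support_derivative_bound:
  fixes f :: "'a::euclidean_space \<Rightarrow> real"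
  assumes "smooth_on UNIV f" and "compact (closure {x. f x \<noteq> 0})"
  obtains L where "0 \<le> L" and "\<And>x h. \<bar>frechet_derivative f (at x) h\<bar> \<le> L * norm h"
proof -
  let ?K = "closure {x. f x \<noteq> 0}"
  have "\<exists>B. \<forall>x. \<bar>frechet_derivative f (at x) b\<bar> \<le> B" for b
  proof -
    have "continuous_on ?K (\<lambda>x. frechet_derivative f (at x) b)"
      using smooth_on_UNIV_derivative_continuous[OF assms(1)] continuous_on_subset by blast
    then have "bounded ((\<lambda>x. frechet_derivative f (at x) b) ` ?K)"
      using assms(2) compact_continuous_image compact_imp_bounded by blast
    then obtain B where B: "\<And>x. x \<in> ?K \<Longrightarrow> \<bar>frechet_derivative f (at x) b\<bar> \<le> B"
      by (auto simp: bounded_iff)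
    have "\<bar>frechet_derivative f (at x) b\<bar> \<le> max B 0" for x
      using B[of x] frechet_derivative_zero_outside_support[of x f] by (cases "x \<in> ?K") auto
    then show ?thesis by blast
  qed
  then obtain B where B: "\<And>b x. \<bar>frechet_derivative f (at x) b\<bar> \<le> B b" by metis
  have B0: "0 \<le> B b" for b using B[of undefined b] by linarith
  have "\<bar>frechet_derivative f (at x) h\<bar> \<le> (\<Sum>b\<in>Basis. B b) * norm h" for x h
  proof -
    have "\<bar>frechet_derivative f (at x) h\<bar> \<le> (\<Sum>b\<in>Basis. \<bar>(h \<bullet> b) * frechet_derivative f (at x) b\<bar>)"
      by (subst smooth_on_UNIV_derivative_inner[OF assms(1)]) (rule sum_abs)
    also have "\<dots> \<le> (\<Sum>b\<in>Basis. norm h * B b)"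
      by (intro sum_mono) (auto simp: abs_mult intro!: mult_mono B B0 Basis_le_norm)
    finally show ?thesis by (simp add: sum_distrib_left mult.commute)
  qed
  then show ?thesis using that[of "\<Sum>b\<in>Basis. B b"] B0 by (auto intro: sum_nonneg)
qed

lemma derivative_bound_lipschitz:
  fixes f :: "'a::euclidean_space \<Rightarrow> real"
  assumes "\<And>x. (f has_derivative f' x) (at x)" and "\<And>x h. \<bar>f' x h\<bar> \<le> L * norm h"
  shows "\<bar>f x - f y\<bar> \<le> L * norm (x - y)"
proof -
  have "norm (f x - f y) \<le> L * norm (x - y)"
    by (rule differentiable_bound[of UNIV f f'])
      (use assms in \<open>auto intro: has_derivative_at_withinI onorm_bound onorm_le\<close>)
  then show ?thesis by simp
qed

section \<open>Convolution in L1\<close>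

lemma lborel_integral_translate:
  fixes f :: "'a::euclidean_space \<Rightarrow> real"
  shows "(\<integral>x. f (z + x) \<partial>lborel) = (\<integral>x. f x \<partial>lborel)"
    and "integrable lborel (\<lambda>x. f (z + x)) \<longleftrightarrow> integrable lborel f"
proof -
  have *: "integrable lborel (\<lambda>x. f (z + x))" if "integrable lborel f" for f :: "'a \<Rightarrow> real" and z
  proof -
    have "integrable (distr lborel borel ((+) z)) f" using that by (simp add: lborel_distr_plus)
    then show ?thesis by (subst (asm) integrable_distr_eq) (use that in auto)
  qed
  show i: "integrable lborel (\<lambda>x. f (z + x)) \<longleftrightarrow> integrable lborel f"
    using *[of f z] *[of "\<lambda>x. f (z + x)" "- z"] by auto
  show "(\<integral>x. f (z + x) \<partial>lborel) = (\<integral>x. f x \<partial>lborel)"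
  proof (cases "integrable lborel f")
    case True
    then have "f \<in> borel_measurable borel" by auto
    then have "(\<integral>x. f x \<partial>distr lborel borel ((+) z)) = (\<integral>x. f (z + x) \<partial>lborel)"
      by (subst integral_distr) auto
    then show ?thesis by (simp add: lborel_distr_plus)
  next
    case False
    \<comment> \<open>Neither function is integrable, so both integrals have the default value
      0.\<close>
    then show ?thesis using i by (simp add: not_integrable_integral_eq)
  qed
qed

lemma lborel_integral_reflect:
  fixes f :: "'a::euclidean_space \<Rightarrow> real"
  assumes "f \<in> borel_measurable borel"
  shows "(\<integral>x. f (z - x) \<partial>lborel) = (\<integral>x. f x \<partial>lborel)"
    and "integrable lborel (\<lambda>x. f (z - x)) \<longleftrightarrow> integrable lborel f"
proof -
  have "lborel = distr lborel borel (\<lambda>x. z - x)"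
    using lborel_affine[of "-1" z] by (simp add: density_1)
  then have "(\<integral>x. f x \<partial>lborel) = (\<integral>x. f x \<partial>distr lborel borel (\<lambda>x. z - x))"
    "integrable lborel f \<longleftrightarrow> integrable (distr lborel borel (\<lambda>x. z - x)) f"
    by auto
  then show "(\<integral>x. f (z - x) \<partial>lborel) = (\<integral>x. f x \<partial>lborel)"
    "integrable lborel (\<lambda>x. f (z - x)) \<longleftrightarrow> integrable lborel f"
    using assms by (simp_all add: integral_distr integrable_distr_eq)
qed

text \<open>Lebesgue measure restricted to A is a finite Borel measure, so inner regularity by
  compact sets applies to it; on subsets of A it agrees with \<open>lborel\<close>.\<close>

lemma lborel_inner_compact:
  fixes A :: "'a::euclidean_space set"
  assumes "A \<in> sets borel" and "emeasure lborel A < \<infinity>" and "0 < (e::real)"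
  obtains K where "compact K" "K \<subseteq> A" "emeasure lborel (A - K) < ennreal e"
proof -
  let ?M = "density lborel (indicator A)"
  have em: "emeasure ?M X = emeasure lborel (A \<inter> X)" if "X \<in> sets borel" for X
    using that assms(1) by (simp add: emeasure_restricted)
  have "emeasure ?M A = (SUP K\<in>{K. K \<subseteq> A \<and> compact K}. emeasure ?M K)"
    by (rule inner_regular) (use assms em[of UNIV] in auto)
  also have "(SUP K\<in>{K. K \<subseteq> A \<and> compact K}. emeasure ?M K)
      = (SUP K\<in>{K. K \<subseteq> A \<and> compact K}. emeasure lborel K)"
    by (intro SUP_cong refl) (auto simp: em compact_imp_closed Int_absorb1)
  finally have *: "emeasure lborel A = (SUP K\<in>{K. K \<subseteq> A \<and> compact K}. emeasure lborel K)"
    using em[OF assms(1)] by simp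
  obtain m where m: "emeasure lborel A = ennreal m" "0 \<le> m"
    using assms(2) by (metis ennreal_cases infinity_ennreal_def less_irrefl)
  show ?thesis
  proof (cases "m < e")
    case True
    \<comment> \<open>Split off because \<open>ennreal (m - e)\<close> would be truncated to 0 here,
      and the strict comparison with the measure of A could fail.\<close>
    show ?thesis by (rule that[of "{}"]) (use m True in \<open>auto simp: ennreal_less_iff\<close>)
  next
    case False
    then have "ennreal (m - e) < emeasure lborel A"
      using assms(3) m by (simp add: ennreal_less_iff)
    then obtain K where K: "K \<subseteq> A" "compact K" "ennreal (m - e) < emeasure lborel K"
      unfolding * by (auto simp: less_SUP_iff)
    have "emeasure lborel K \<le> ennreal m"
      using K(1) m(1) assms(1) by (metis emeasure_mono sets_lborel)
    then obtain k where k: "emeasure lborel K = ennreal k" "0 \<le> k"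
      by (metis ennreal_cases neq_top_trans ennreal_neq_top)
    have "emeasure lborel (A - K) = ennreal m - ennreal k"
      using K m k assms(1) by (subst emeasure_Diff) (auto simp: compact_imp_closed)
    also have "\<dots> = ennreal (m - k)" using k by (simp add: ennreal_minus)
    also have "\<dots> < ennreal e"
      using K(3) k False assms(3) by (auto simp: ennreal_less_iff intro!: ennreal_lessI)
    finally show ?thesis using that K by blast
  qed
qed

text \<open>Squeeze A between a compact K and an open V such that V - K has measure below e/2. If z
  is shorter than the distance that K keeps from the complement of V, the two indicators can differ
  at x only if x or z + x lies in V - K, which costs at most twice that measure.\<close>

lemma L1_translation_continuous_indicator:
  fixes A :: "'a::euclidean_space set"
  assumes A: "A \<in> sets borel" and fin: "emeasure lborel A < \<infinity>" and e: "0 < (e::real)"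
  shows "\<exists>d>0. \<forall>z. norm z < d \<longrightarrow> (\<integral>x. \<bar>indicator A (z + x) - indicator A x :: real\<bar> \<partial>lborel) < e"
proof -
  obtain K where K: "compact K" "K \<subseteq> A" "emeasure lborel (A - K) < ennreal (e/4)"
    using lborel_inner_compact[OF A fin, of "e/4"] e by auto
  obtain V where V: "open V" "A \<subseteq> V" "emeasure lborel (V - A) < ennreal (e/4)"
    using outer_regular_lborel[OF A, of "e/4"] e by auto
  have [measurable]: "K \<in> sets borel" "V \<in> sets borel"
    using K V by (auto simp: compact_imp_closed)
  obtain d where d: "0 < d" "(\<Union>x\<in>K. ball x d) \<subseteq> V"
    using compact_subset_open_imp_ball_epsilon_subset[OF K(1) V(1)] K V by blast
  let ?B = "V - K"
  have "emeasure lborel ?B \<le> emeasure lborel (V - A) + emeasure lborel (A - K)"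
    using A by (intro emeasure_subadditive[THEN order_trans[rotated]] emeasure_mono) auto
  also have "\<dots> < ennreal (e/4) + ennreal (e/4)"
    using K V by (intro add_strict_mono)
  also have "\<dots> = ennreal (e/2)" using e by (simp flip: ennreal_plus)
  finally have B: "emeasure lborel ?B < ennreal (e/2)" .
  have iB: "integrable lborel (indicator ?B :: 'a \<Rightarrow> real)"
    using B by (auto intro!: integrable_real_indicator order.strict_trans[OF B])
  have mB: "measure lborel ?B < e/2"
    using B e by (cases "emeasure lborel ?B") (auto simp: measure_def ennreal_less_iff)
  have iA: "integrable lborel (indicator A :: 'a \<Rightarrow> real)"
    using A fin by simp
  have "(\<integral>x. \<bar>indicator A (z + x) - indicator A x :: real\<bar> \<partial>lborel) < e" if z: "norm z < d" for z
  proof -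
    have iBz: "integrable lborel (\<lambda>x. indicator ?B (z + x) :: real)"
      using iB by (simp add: lborel_integral_translate(2))
    have iAz: "integrable lborel (\<lambda>x. indicator A (z + x) :: real)"
      using iA by (simp add: lborel_integral_translate(2))
    have KV: "z + x \<in> V" "x - z \<in> V" if "x \<in> K" for x
      using d(2) that z by (auto simp: subset_eq dist_norm)
    have "(\<integral>x. \<bar>indicator A (z + x) - indicator A x :: real\<bar> \<partial>lborel)
        \<le> (\<integral>x. indicator ?B x + indicator ?B (z + x) \<partial>lborel)"
    proof (rule integral_mono)
      show "\<bar>indicator A (z + x) - indicator A x :: real\<bar> \<le> indicator ?B x + indicator ?B (z + x)" for x
        using KV(1)[of x] KV(2)[of "z + x"] K(2) V(2) by (auto simp: indicator_def)
    qed (use iA iAz iB iBz in auto)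
    also have "\<dots> = 2 * measure lborel ?B"
      using iB iBz by (subst Bochner_Integration.integral_add)
        (auto simp: lborel_integral_translate(1)[of "indicator ?B"])
    finally show ?thesis using mB by linarith
  qed
  with d(1) show ?thesis by blast
qed

lemma L1_translation_continuous:
  fixes f :: "'a::euclidean_space \<Rightarrow> real"
  assumes "integrable lborel f" and "0 < (e::real)"
  shows "\<exists>d>0. \<forall>z. norm z < d \<longrightarrow> (\<integral>x. \<bar>f (z + x) - f x\<bar> \<partial>lborel) < e"
  using assms
proof (induction f arbitrary: e rule: integrable_induct)
  case (base A c)
  \<comment> \<open>The summand 1 covers c = 0, where dividing by the absolute value of c is
    useless.\<close>
  have "0 < e / (\<bar>c\<bar> + 1)" using base by (simp add: divide_pos_pos)
  then obtain d where d: "0 < d"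
    "\<And>z. norm z < d \<Longrightarrow> (\<integral>x. \<bar>indicator A (z + x) - indicator A x :: real\<bar> \<partial>lborel) < e / (\<bar>c\<bar> + 1)"
    using L1_translation_continuous_indicator[of A "e / (\<bar>c\<bar> + 1)"] base by auto
  have "(\<integral>x. \<bar>indicator A (z + x) *\<^sub>R c - indicator A x *\<^sub>R c\<bar> \<partial>lborel) < e" if "norm z < d" for z
  proof -
    let ?I = "\<integral>x. \<bar>indicator A (z + x) - indicator A x :: real\<bar> \<partial>lborel"
    have "(\<integral>x. \<bar>indicator A (z + x) *\<^sub>R c - indicator A x *\<^sub>R c\<bar> \<partial>lborel) = ?I * \<bar>c\<bar>"
      by (simp add: abs_mult flip: left_diff_distrib)
    also have "\<dots> \<le> ?I * (\<bar>c\<bar> + 1)" by (intro mult_left_mono) auto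
    also have "\<dots> < e" using d(2)[OF that] by (simp add: pos_less_divide_eq)
    finally show ?thesis .
  qed
  with d(1) show ?case by blast
next
  case (add f g)
  from add.IH(1)[of "e/2"] add.IH(2)[of "e/2"] add.prems obtain d1 d2 where
    d: "d1 > 0" "\<And>z. norm z < d1 \<Longrightarrow> (\<integral>x. \<bar>f (z + x) - f x\<bar> \<partial>lborel) < e/2"
       "d2 > 0" "\<And>z. norm z < d2 \<Longrightarrow> (\<integral>x. \<bar>g (z + x) - g x\<bar> \<partial>lborel) < e/2"
    by (auto 0 3)
  have "(\<integral>x. \<bar>f (z + x) + g (z + x) - (f x + g x)\<bar> \<partial>lborel) < e" if "norm z < min d1 d2" for z
  proof -
    have i: "integrable lborel (\<lambda>x. f (z + x))" "integrable lborel (\<lambda>x. g (z + x))"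
      using add.hyps by (simp_all add: lborel_integral_translate(2))
    have "(\<integral>x. \<bar>f (z + x) + g (z + x) - (f x + g x)\<bar> \<partial>lborel)
        \<le> (\<integral>x. \<bar>f (z + x) - f x\<bar> + \<bar>g (z + x) - g x\<bar> \<partial>lborel)"
      using add.hyps i by (intro integral_mono) auto
    also have "\<dots> = (\<integral>x. \<bar>f (z + x) - f x\<bar> \<partial>lborel) + (\<integral>x. \<bar>g (z + x) - g x\<bar> \<partial>lborel)"
      using add.hyps i by (intro Bochner_Integration.integral_add) auto
    finally show ?thesis using d(2,4)[of z] that by auto
  qed
  with d(1,3) show ?case by (intro exI[of _ "min d1 d2"]) auto
next
  case (lim f s)
  have [measurable]: "f \<in> borel_measurable borel" "\<And>i. s i \<in> borel_measurable borel"
    using lim.hyps by auto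
  have "(\<lambda>i. \<integral>x. \<bar>s i x - f x\<bar> \<partial>lborel) \<longlonglongrightarrow> (\<integral>x. \<bar>f x - f x\<bar> \<partial>lborel)"
  \<comment> \<open>The approximating simple functions satisfy
    \<open>\<bar>s i x\<bar> \<le> 2 * \<bar>f x\<bar>\<close>, hence the factor 3.\<close>
  proof (rule integral_dominated_convergence[where w="\<lambda>x. 3 * \<bar>f x\<bar>"])
    show "AE x in lborel. norm \<bar>s i x - f x\<bar> \<le> 3 * \<bar>f x\<bar>" for i
    proof (rule AE_I2)
      show "norm \<bar>s i x - f x\<bar> \<le> 3 * \<bar>f x\<bar>" for x using lim.hyps(3)[of x i] by auto
    qed
    show "AE x in lborel. (\<lambda>i. \<bar>s i x - f x\<bar>) \<longlonglongrightarrow> \<bar>f x - f x\<bar>"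
      using lim.hyps(2) by (intro AE_I2 tendsto_intros) auto
  qed (use lim.hyps in auto)
  then have "(\<lambda>i. \<integral>x. \<bar>s i x - f x\<bar> \<partial>lborel) \<longlonglongrightarrow> 0" by simp
  then obtain i where i: "(\<integral>x. \<bar>s i x - f x\<bar> \<partial>lborel) < e/4"
    using order_tendstoD(2)[of _ 0 sequentially "e/4"] lim.prems
    by (fastforce simp: eventually_sequentially)
  obtain d where d: "d > 0" "\<And>z. norm z < d \<Longrightarrow> (\<integral>x. \<bar>s i (z + x) - s i x\<bar> \<partial>lborel) < e/2"
    using lim.IH[of "e/2" i] lim.prems by auto
  have "(\<integral>x. \<bar>f (z + x) - f x\<bar> \<partial>lborel) < e" if "norm z < d" for z
  proof -
    let ?g = "\<lambda>x. \<bar>s i x - f x\<bar>"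
    have g: "integrable lborel ?g" using lim.hyps by auto
    have j: "integrable lborel (\<lambda>x. f (z + x))" "integrable lborel (\<lambda>x. s i (z + x))"
      "integrable lborel (\<lambda>x. ?g (z + x))"
      using lim.hyps g by (simp_all add: lborel_integral_translate(2))
    have "(\<integral>x. \<bar>f (z + x) - f x\<bar> \<partial>lborel)
        \<le> (\<integral>x. ?g (z + x) + (\<bar>s i (z + x) - s i x\<bar> + ?g x) \<partial>lborel)"
      using lim.hyps j g by (intro integral_mono) auto
    also have "\<dots> = (\<integral>x. ?g (z + x) \<partial>lborel) + ((\<integral>x. \<bar>s i (z + x) - s i x\<bar> \<partial>lborel) + (\<integral>x. ?g x \<partial>lborel))"
      using lim.hyps j g by (subst Bochner_Integration.integral_add) auto
    also have "(\<integral>x. ?g (z + x) \<partial>lborel) = (\<integral>x. ?g x \<partial>lborel)"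
      by (rule lborel_integral_translate(1))
    finally show ?thesis using i d(2)[OF that] by linarith
  qed
  with d(1) show ?case by blast
qed

section \<open>Convolution with a kernel\<close>

definition convolve :: "('a::euclidean_space \<Rightarrow> real) \<Rightarrow> ('a \<Rightarrow> real) \<Rightarrow> 'a \<Rightarrow> real" where
  "convolve f k x = (\<integral>y. f y * k (x - y) \<partial>lborel)"

lemma integrable_mult_bounded:
  fixes f g :: "'a \<Rightarrow> real"
  assumes "integrable M f" and "g \<in> borel_measurable M" and "\<And>x. \<bar>g x\<bar> \<le> C"
  shows "integrable M (\<lambda>x. f x * g x)"
proof (rule Bochner_Integration.integrable_bound)
  show "integrable M (\<lambda>x. C * f x)" using assms by simp
  show "AE x in M. norm (f x * g x) \<le> norm (C * f x)"
  proof (rule AE_I2)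
    fix x
    have "\<bar>g x\<bar> \<le> \<bar>C\<bar>" using assms(3)[of x] by linarith
    then show "norm (f x * g x) \<le> norm (C * f x)"
      by (simp add: abs_mult mult.commute[of "\<bar>C\<bar>"] mult_left_mono)
  qed
qed (use assms in auto)

lemma convolve_measurable:
  assumes [measurable]: "f \<in> borel_measurable borel" "k \<in> borel_measurable borel"
  shows "convolve f k \<in> borel_measurable borel"
  unfolding convolve_def by measurable

text \<open>As \<eta> has mass 1, the difference at x is the \<eta>-average over z of
  \<open>f (x - z) - f x\<close>. Exchanging the nonnegative integrals leaves the \<eta>-average of
  the L1 distances between f and its translates; the support condition keeps only z shorter than r,
  where they are at most e.\<close>

lemma convolve_L1_approx:
  fixes f \<eta> :: "'a::euclidean_space \<Rightarrow> real"
  assumes f: "integrable lborel f"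
    and \<eta>: "integrable lborel \<eta>" "\<And>z. 0 \<le> \<eta> z" "\<And>z. \<eta> z \<le> C" "(\<integral>z. \<eta> z \<partial>lborel) = 1"
    and supp: "\<And>z. r \<le> norm z \<Longrightarrow> \<eta> z = 0"
    and e: "0 \<le> e" "\<And>z. norm z < r \<Longrightarrow> (\<integral>x. \<bar>f (z + x) - f x\<bar> \<partial>lborel) \<le> e"
  shows "integrable lborel (\<lambda>x. convolve f \<eta> x - f x)"
    and "(\<integral>x. \<bar>convolve f \<eta> x - f x\<bar> \<partial>lborel) \<le> e"
proof -
  have [measurable]: "f \<in> borel_measurable borel" "\<eta> \<in> borel_measurable borel" using f \<eta> by auto
  have [measurable]: "convolve f \<eta> \<in> borel_measurable borel" by (rule convolve_measurable) auto
  have \<eta>C: "\<bar>\<eta> z\<bar> \<le> C" for z using \<eta>(2,3)[of z] by simp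
  have pt: "ennreal \<bar>convolve f \<eta> x - f x\<bar> \<le> (\<integral>\<^sup>+z. ennreal (\<bar>f (x - z) - f x\<bar> * \<eta> z) \<partial>lborel)" for x
  proof -
    have i1: "integrable lborel (\<lambda>z. f (x - z) * \<eta> z)"
      using f \<eta>C by (intro integrable_mult_bounded) (auto simp: lborel_integral_reflect(2))
    have "convolve f \<eta> x = (\<integral>z. f (x - z) * \<eta> z \<partial>lborel)"
      using lborel_integral_reflect(1)[of "\<lambda>y. f y * \<eta> (x - y)" x] by (simp add: convolve_def)
    then have "convolve f \<eta> x - f x = (\<integral>z. f (x - z) * \<eta> z \<partial>lborel) - (\<integral>z. f x * \<eta> z \<partial>lborel)"
      using \<eta> by simp
    also have "\<dots> = (\<integral>z. (f (x - z) - f x) * \<eta> z \<partial>lborel)"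
      using i1 \<eta> by (subst Bochner_Integration.integral_diff[symmetric]) (auto simp: algebra_simps)
    finally have "convolve f \<eta> x - f x = (\<integral>z. (f (x - z) - f x) * \<eta> z \<partial>lborel)" .
    moreover have "integrable lborel (\<lambda>z. (f (x - z) - f x) * \<eta> z)"
      using i1 \<eta> by (simp add: left_diff_distrib)
    ultimately have "ennreal \<bar>convolve f \<eta> x - f x\<bar> \<le> (\<integral>\<^sup>+z. norm ((f (x - z) - f x) * \<eta> z) \<partial>lborel)"
      by (metis integral_norm_bound_ennreal real_norm_def)
    then show ?thesis using \<eta>(2) by (simp add: abs_mult)
  qed
  have "(\<integral>\<^sup>+x. ennreal \<bar>convolve f \<eta> x - f x\<bar> \<partial>lborel)
      \<le> (\<integral>\<^sup>+x. \<integral>\<^sup>+z. ennreal (\<bar>f (x - z) - f x\<bar> * \<eta> z) \<partial>lborel \<partial>lborel)"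
    by (intro nn_integral_mono pt)
  also have "\<dots> = (\<integral>\<^sup>+z. \<integral>\<^sup>+x. ennreal (\<bar>f (x - z) - f x\<bar> * \<eta> z) \<partial>lborel \<partial>lborel)"
    by (rule lborel_pair.Fubini') measurable
  also have "\<dots> \<le> (\<integral>\<^sup>+z. ennreal (e * \<eta> z) \<partial>lborel)"
  proof (rule nn_integral_mono)
    fix z :: 'a
    show "(\<integral>\<^sup>+x. ennreal (\<bar>f (x - z) - f x\<bar> * \<eta> z) \<partial>lborel) \<le> ennreal (e * \<eta> z)"
    proof (cases "norm z < r")
      case True
      have i: "integrable lborel (\<lambda>x. f (x - z))"
        using lborel_integral_translate(2)[of f "- z"] f by simp
      have "(\<integral>\<^sup>+x. ennreal (\<bar>f (x - z) - f x\<bar> * \<eta> z) \<partial>lborel)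
          = ennreal (\<integral>x. \<bar>f (x - z) - f x\<bar> * \<eta> z \<partial>lborel)"
        using i f \<eta>(2) by (intro nn_integral_eq_integral) auto
      also have "\<dots> \<le> ennreal (e * \<eta> z)"
        using e(2)[of "- z"] True \<eta>(2) by (auto intro!: ennreal_leI mult_right_mono)
      finally show ?thesis .
    next
      case False
      then show ?thesis using supp[of z] by simp
    qed
  qed
  also have "\<dots> = ennreal (\<integral>z. e * \<eta> z \<partial>lborel)"
    using \<eta> e by (intro nn_integral_eq_integral) auto
  also have "\<dots> = ennreal e" using \<eta> by simp
  finally have *: "(\<integral>\<^sup>+x. ennreal \<bar>convolve f \<eta> x - f x\<bar> \<partial>lborel) \<le> ennreal e" .
  then show i: "integrable lborel (\<lambda>x. convolve f \<eta> x - f x)"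
    by (intro integrableI_bounded) (auto intro: le_less_trans)
  have "ennreal (\<integral>x. \<bar>convolve f \<eta> x - f x\<bar> \<partial>lborel) \<le> ennreal e"
    using * i by (subst nn_integral_eq_integral[symmetric]) auto
  then show "(\<integral>x. \<bar>convolve f \<eta> x - f x\<bar> \<partial>lborel) \<le> e"
    using e(1) by (subst (asm) ennreal_le_iff) auto
qed

text \<open>Differentiation under the integral: the normalised Taylor remainder of k tends to 0
  pointwise and is bounded by 2L, where L is a Lipschitz constant of k, so 2L times the absolute
  value of f dominates.\<close>

lemma convolve_has_derivative:
  fixes f k :: "'a::euclidean_space \<Rightarrow> real"
  assumes f: "integrable lborel f"
    and k: "smooth_on UNIV k" "compact (closure {x. k x \<noteq> 0})"
  shows "(convolve f k has_derivative
    (\<lambda>h. convolve f (\<lambda>z. frechet_derivative k (at z) h) x)) (at x)"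
proof -
  let ?k' = "\<lambda>z. frechet_derivative k (at z)"
  have kd: "(k has_derivative ?k' z) (at z)" for z
    by (rule smooth_on_UNIV_has_derivative[OF k(1)])
  obtain L where L: "0 \<le> L" "\<And>z h. \<bar>?k' z h\<bar> \<le> L * norm h"
    by (rule smooth_compact_support_derivative_bound[OF k]) blast
  have lip: "\<bar>k y - k z\<bar> \<le> L * norm (y - z)" for y z
    by (rule derivative_bound_lipschitz[OF kd L(2)])
  have [measurable]: "f \<in> borel_measurable borel" using f by auto
  have [measurable]: "k \<in> borel_measurable borel"
    by (intro borel_measurable_continuous_onI smooth_on_UNIV_continuous k)
  have [measurable]: "(\<lambda>z. ?k' z h) \<in> borel_measurable borel" for h
    by (intro borel_measurable_continuous_onI smooth_on_UNIV_derivative_continuous k)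
  have "bounded (range k)"
  proof -
    have "bounded (k ` closure {x. k x \<noteq> 0})"
      using k by (intro compact_imp_bounded compact_continuous_image)
        (auto intro: continuous_on_subset[OF smooth_on_UNIV_continuous])
    moreover have "range k \<subseteq> insert 0 (k ` closure {x. k x \<noteq> 0})"
      using closure_subset[of "{x. k x \<noteq> 0}"] by auto
    ultimately show ?thesis by (meson bounded_insert bounded_subset)
  qed
  then obtain C where C: "\<And>z. \<bar>k z\<bar> \<le> C" by (auto simp: bounded_iff)
  have ik: "integrable lborel (\<lambda>y. f y * k (w - y))" for w
    using f C by (intro integrable_mult_bounded) auto
  have ik': "integrable lborel (\<lambda>y. f y * ?k' (w - y) h)" for w h
    using f L by (intro integrable_mult_bounded) auto
  have lin: "linear (?k' z)" for z using kd by (rule has_derivative_linear)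
  have bl: "bounded_linear (\<lambda>h. convolve f (\<lambda>z. ?k' z h) x)"
  proof (rule linear_conv_bounded_linear[THEN iffD1], rule linearI)
    show "convolve f (\<lambda>z. ?k' z (b1 + b2)) x
        = convolve f (\<lambda>z. ?k' z b1) x + convolve f (\<lambda>z. ?k' z b2) x" for b1 b2
      unfolding convolve_def
      by (subst Bochner_Integration.integral_add[symmetric])
        (use ik' in \<open>auto simp: linear_add[OF lin] distrib_left\<close>)
    show "convolve f (\<lambda>z. ?k' z (c *\<^sub>R b)) x = c *\<^sub>R convolve f (\<lambda>z. ?k' z b) x" for c b
      unfolding convolve_def by (simp add: linear_scale[OF lin] mult.left_commute)
  qed
  \<comment> \<open>At x' = x the division by 0 gives 0, so the bound 2L below holds without
    exception.\<close>
  define Q where "Q x' y = (k (x' - y) - k (x - y) - ?k' (x - y) (x' - x)) / norm (x' - x)" for x' y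
  have [measurable]: "Q x' \<in> borel_measurable borel" for x' unfolding Q_def by measurable
  have Qb: "\<bar>Q x' y\<bar> \<le> 2 * L" for x' y
  proof -
    have "\<bar>k (x' - y) - k (x - y) - ?k' (x - y) (x' - x)\<bar> \<le> 2 * L * norm (x' - x)"
      using lip[of "x' - y" "x - y"] L(2)[of "x - y" "x' - x"] by simp
    then show ?thesis using L(1) by (cases "x' = x") (auto simp: Q_def divide_simps)
  qed
  have Qlim: "((\<lambda>x'. Q x' y) \<longlongrightarrow> 0) (at x)" for y
  proof -
    have "((\<lambda>x'. x' - y) has_derivative (\<lambda>h. h)) (at x)"
      by (auto intro!: derivative_eq_intros)
    from has_derivative_compose[OF this kd]
    have "((\<lambda>x'. k (x' - y)) has_derivative ?k' (x - y)) (at x)" by simp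
    then have "((\<lambda>x'. norm (k (x' - y) - k (x - y) - ?k' (x - y) (x' - x)) / norm (x' - x)) \<longlongrightarrow> 0) (at x)"
      by (simp add: has_derivative_iff_norm)
    then have "((\<lambda>x'. norm (Q x' y)) \<longlongrightarrow> 0) (at x)" by (simp add: Q_def)
    then show ?thesis by (rule tendsto_norm_zero_cancel)
  qed
  have "((\<lambda>x'. \<integral>y. f y * Q x' y \<partial>lborel) \<longlongrightarrow> 0) (at x)"
  proof (subst tendsto_at_iff_sequentially, intro allI impI)
    fix X :: "nat \<Rightarrow> 'a"
    assume X: "\<forall>i. X i \<in> UNIV - {x}" "X \<longlonglongrightarrow> x"
    have "(\<lambda>i. \<integral>y. f y * Q (X i) y \<partial>lborel) \<longlonglongrightarrow> (\<integral>y. f y * 0 \<partial>lborel)"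
    proof (rule integral_dominated_convergence[where w="\<lambda>y. \<bar>f y\<bar> * (2 * L)"])
      show "AE y in lborel. (\<lambda>i. f y * Q (X i) y) \<longlonglongrightarrow> f y * 0"
        using Qlim X by (intro AE_I2 tendsto_mult tendsto_const)
          (auto simp: tendsto_at_iff_sequentially comp_def)
      show "AE y in lborel. norm (f y * Q (X i) y) \<le> \<bar>f y\<bar> * (2 * L)" for i
        using Qb by (intro AE_I2) (auto simp: abs_mult intro!: mult_left_mono)
    qed (use f in auto)
    then show "((\<lambda>x'. \<integral>y. f y * Q x' y \<partial>lborel) \<circ> X) \<longlonglongrightarrow> 0" by (simp add: comp_def)
  qed
  moreover have "(\<integral>y. f y * Q x' y \<partial>lborel)
      = (convolve f k x' - convolve f k x - convolve f (\<lambda>z. ?k' z (x' - x)) x) / norm (x' - x)" for x'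
  proof -
    have "(\<integral>y. f y * Q x' y \<partial>lborel)
        = (\<integral>y. (f y * k (x' - y) - f y * k (x - y) - f y * ?k' (x - y) (x' - x)) / norm (x' - x) \<partial>lborel)"
      by (simp add: Q_def algebra_simps)
    also have "\<dots> = (\<integral>y. f y * k (x' - y) - f y * k (x - y) - f y * ?k' (x - y) (x' - x) \<partial>lborel) / norm (x' - x)"
      by simp
    also have "(\<integral>y. f y * k (x' - y) - f y * k (x - y) - f y * ?k' (x - y) (x' - x) \<partial>lborel)
        = convolve f k x' - convolve f k x - convolve f (\<lambda>z. ?k' z (x' - x)) x"
      unfolding convolve_def using ik ik' by (simp add: Bochner_Integration.integral_diff)
    finally show ?thesis .
  qed
  ultimately have "((\<lambda>x'. (convolve f k x' - convolve f k x - convolve f (\<lambda>z. ?k' z (x' - x)) x) / norm (x' - x)) \<longlongrightarrow> 0) (at x)"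
    by simp
  from tendsto_norm_zero[OF this] show ?thesis
    using bl by (simp add: has_derivative_iff_norm)
qed

text \<open>By translation invariance every difference quotient of w in direction b has integral 0.
  The mean value theorem bounds the quotients by C and they vanish outside a fixed ball, so
  dominated convergence passes to the derivative. Applied to products, this is integration by parts
  without boundary term.\<close>

lemma integral_directional_derivative_zero:
  fixes w w' :: "'a::euclidean_space \<Rightarrow> real"
  assumes w: "w \<in> borel_measurable borel" "bounded {x. w x \<noteq> 0}" "\<And>x. \<bar>w x\<bar> \<le> B"
    and w': "\<And>x. \<bar>w' x\<bar> \<le> C"
    and deriv: "\<And>x. ((\<lambda>t. w (x + t *\<^sub>R b)) has_real_derivative w' x) (at 0)"
  shows "(\<integral>x. w' x \<partial>lborel) = 0"
proof -
  have [measurable]: "w \<in> borel_measurable borel" by fact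
  \<comment> \<open>Differentiability is assumed at t = 0 but for every base point; moving the base
    point gives it along the whole line, as the mean value theorem requires.\<close>
  have deriv': "((\<lambda>t. w (x + t *\<^sub>R b)) has_real_derivative w' (x + s *\<^sub>R b)) (at s)" for x s
  proof -
    have "((\<lambda>t. w ((x + s *\<^sub>R b) + t *\<^sub>R b)) has_real_derivative w' (x + s *\<^sub>R b)) (at 0)"
      by (rule deriv)
    then have "((\<lambda>t. w (x + (t + s) *\<^sub>R b)) has_real_derivative w' (x + s *\<^sub>R b)) (at 0)"
      by (simp add: algebra_simps)
    then show ?thesis using DERIV_shift[of "\<lambda>t. w (x + t *\<^sub>R b)" "w' (x + s *\<^sub>R b)" 0 s] by simp
  qed
  obtain R where R: "\<And>x. w x \<noteq> 0 \<Longrightarrow> norm x \<le> R"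
    using w(2) by (auto simp: bounded_iff)
  \<comment> \<open>The radius is enlarged by the length of b so that outside S neither x nor a
    point shifted by at most b meets the support of w.\<close>
  define S where "S = cball (0::'a) (R + norm b)"
  have iw: "integrable lborel w"
  proof (rule Bochner_Integration.integrable_bound)
    show "integrable lborel (\<lambda>x. B * indicator S x :: real)"
      using emeasure_bounded_finite[of S]
      by (auto simp: S_def intro!: integrable_real_indicator Bochner_Integration.integrable_mult_right)
    show "AE x in lborel. norm (w x) \<le> norm (B * indicator S x :: real)"
    proof (rule AE_I2)
      fix x show "norm (w x) \<le> norm (B * indicator S x :: real)"
        using w(3)[of x] R[of x] by (cases "w x = 0") (auto simp: S_def indicator_def add_increasing2)
    qed
  qed auto
  define q where "q n x = real (Suc n) * (w (x + (1 / real (Suc n)) *\<^sub>R b) - w x)" for n x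
  have [measurable]: "q n \<in> borel_measurable borel" for n unfolding q_def by measurable
  have qlim: "(\<lambda>n. q n x) \<longlonglongrightarrow> w' x" for x
  proof -
    have "((\<lambda>t. (w (x + t *\<^sub>R b) - w x) / t) \<longlongrightarrow> w' x) (at 0)"
      using deriv[of x] by (simp add: DERIV_def)
    moreover have "filterlim (\<lambda>n. 1 / real (Suc n)) (at 0) sequentially"
      using LIMSEQ_Suc[OF lim_1_over_n[where 'a=real]] by (auto simp: filterlim_at)
    ultimately have "(\<lambda>n. (w (x + (1 / real (Suc n)) *\<^sub>R b) - w x) / (1 / real (Suc n))) \<longlonglongrightarrow> w' x"
      by (rule filterlim_compose)
    then show ?thesis by (simp add: q_def mult.commute)
  qed
  have qb: "\<bar>q n x\<bar> \<le> C * indicator S x" for n x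
  proof (cases "x \<in> S")
    case True
    let ?t = "1 / real (Suc n)"
    have "\<exists>z. 0 < z \<and> z < ?t \<and> w (x + ?t *\<^sub>R b) - w (x + 0 *\<^sub>R b) = (?t - 0) * w' (x + z *\<^sub>R b)"
      by (rule MVT2) (auto intro: deriv')
    then obtain z where "w (x + ?t *\<^sub>R b) - w x = ?t * w' (x + z *\<^sub>R b)" by auto
    then have "q n x = w' (x + z *\<^sub>R b)" by (simp add: q_def)
    then show ?thesis using True w' by simp
  next
    case False
    then have n: "norm x > R + norm b" by (simp add: S_def)
    let ?t = "1 / real (Suc n)"
    have "norm (?t *\<^sub>R b) \<le> norm b" by (simp add: divide_simps mult_le_cancel_left1 distrib_right)
    then have "norm (x + ?t *\<^sub>R b) > R" using n norm_diff_ineq[of x "?t *\<^sub>R b"] by linarith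
    then have "w (x + ?t *\<^sub>R b) = 0" using R by force
    moreover have "w x = 0" using R[of x] n norm_ge_zero[of b] by linarith
    ultimately show ?thesis using False by (simp add: q_def)
  qed
  have "(\<lambda>n. \<integral>x. q n x \<partial>lborel) \<longlonglongrightarrow> (\<integral>x. w' x \<partial>lborel)"
  proof (rule integral_dominated_convergence[where w="\<lambda>x. C * indicator S x"])
    show "integrable lborel (\<lambda>x. C * indicator S x :: real)"
      using emeasure_bounded_finite[of S]
      by (auto simp: S_def intro!: integrable_real_indicator Bochner_Integration.integrable_mult_right)
    \<comment> \<open>Measurability of the derivative is inherited from the quotients, whose
      pointwise limit it is.\<close>
    show "w' \<in> borel_measurable lborel"
      using borel_measurable_LIMSEQ_real[of lborel q w'] qlim by auto
  qed (use qb qlim in auto)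
  moreover have "(\<integral>x. q n x \<partial>lborel) = 0" for n
    using iw lborel_integral_translate[of w "(1 / real (Suc n)) *\<^sub>R b"]
    by (simp add: q_def add.commute)
  ultimately show ?thesis by (simp add: LIMSEQ_const_iff)
qed

section \<open>Mollifiers and weak partial derivatives\<close>

text \<open>The standard bump exp(-1/(r^2 - |x|^2)) on the ball of radius r, extended by 0.\<close>

definition bump :: "real \<Rightarrow> 'a::euclidean_space \<Rightarrow> real" where
  "bump r x = flat 1 (r\<^sup>2 - x \<bullet> x)"

text \<open>Each radius has its own bump and its own normalisation, instead of rescaling one kernel:
  \<open>convolve_L1_approx\<close> asks only for a nonnegative bounded kernel of mass 1 supported
  in the ball of radius r.\<close>

definition mollifier :: "real \<Rightarrow> 'a::euclidean_space \<Rightarrow> real" where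
  "mollifier r x = bump r x / (\<integral>x. bump r x \<partial>(lborel :: 'a measure))"

lemma bump_smooth_alg: "smooth_alg r a (\<lambda>x. bump r (a - x))"
proof -
  have "bump r (a - x) = flat 1 (r\<^sup>2 - (x - a) \<bullet> (x - a))" for x
    by (simp add: bump_def inner_commute algebra_simps)
  then show ?thesis using smooth_alg.flat[of r a 1] by simp
qed

text \<open>This is the kernel of the convolution at \<open>a\<close> as a function of the
  integration variable. The centre parameter of \<open>smooth_alg\<close> makes it a member
  directly, without composition with a reflection.\<close>

lemma mollifier_smooth_on: "smooth_on UNIV (\<lambda>x. mollifier r (a - x))"
proof -
  have "smooth_alg r a (\<lambda>x. inverse (\<integral>x. bump r x \<partial>(lborel :: 'a measure)) * bump r (a - x))"
    by (intro smooth_alg.mult smooth_alg.const bump_smooth_alg)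
  then show ?thesis
    by (intro smooth_alg_smooth_on) (simp add: mollifier_def divide_inverse mult.commute)
qed

lemma mollifier_minus: "mollifier r (- x) = mollifier r x"
  by (simp add: mollifier_def bump_def)

lemma mollifier_smooth_on': "smooth_on UNIV (mollifier r)"
  using mollifier_smooth_on[of r 0] by (simp add: mollifier_minus)

lemma bump_pos_iff:
  assumes "0 < r"
  shows "bump r x > 0 \<longleftrightarrow> norm x < r" and "bump r x \<ge> 0" and "bump r x \<le> 1"
proof -
  have "x \<bullet> x < r\<^sup>2 \<longleftrightarrow> norm x < r"
    using assms by (simp add: norm_lt_square)
  then show "bump r x > 0 \<longleftrightarrow> norm x < r" and "bump r x \<ge> 0" and "bump r x \<le> 1"
    by (auto simp: bump_def flat_def)
qed

lemma compact_closure_support: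
  fixes f :: "'a::euclidean_space \<Rightarrow> real"
  assumes "\<And>x. f x \<noteq> 0 \<Longrightarrow> x \<in> cball a r"
  shows "compact (closure {x. f x \<noteq> 0})" and "closure {x. f x \<noteq> 0} \<subseteq> cball a r"
proof -
  show "closure {x. f x \<noteq> 0} \<subseteq> cball a r"
    using assms by (intro closure_minimal) auto
  then show "compact (closure {x. f x \<noteq> 0})"
    by (meson bounded_cball bounded_subset compact_closure closure_subset order_trans)
qed

lemma smooth_compact_support_facts:
  fixes f :: "'a::euclidean_space \<Rightarrow> real"
  assumes f: "smooth_on UNIV f" "compact (closure {x. f x \<noteq> 0})"
  shows "f \<in> borel_measurable borel" and "(\<lambda>x. frechet_derivative f (at x) h) \<in> borel_measurable borel"
    and "integrable lborel f" and "integrable lborel (\<lambda>x. frechet_derivative f (at x) h)"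
    and "\<exists>P. \<forall>x. \<bar>f x\<bar> \<le> P"
proof -
  let ?K = "closure {x. f x \<noteq> 0}"
  show m: "f \<in> borel_measurable borel" "(\<lambda>x. frechet_derivative f (at x) h) \<in> borel_measurable borel"
    using smooth_on_UNIV_continuous[OF f(1)] smooth_on_UNIV_derivative_continuous[OF f(1)]
    by (auto intro: borel_measurable_continuous_onI)
  have z: "f x = 0" "frechet_derivative f (at x) h = 0" if "x \<notin> ?K" for x
    using that closure_subset[of "{x. f x \<noteq> 0}"] frechet_derivative_zero_outside_support[of x f]
    by auto
  have "bounded (f ` ?K)"
    using f by (intro compact_imp_bounded compact_continuous_image)
      (auto intro: continuous_on_subset[OF smooth_on_UNIV_continuous])
  then obtain P where "\<And>x. x \<in> ?K \<Longrightarrow> \<bar>f x\<bar> \<le> P" by (auto simp: bounded_iff)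
  then have P: "\<bar>f x\<bar> \<le> max P 0" for x using z(1)[of x] by (cases "x \<in> ?K") (auto simp: le_max_iff_disj)
  then show "\<exists>P. \<forall>x. \<bar>f x\<bar> \<le> P" by blast
  obtain L where L: "\<And>x h. \<bar>frechet_derivative f (at x) h\<bar> \<le> L * norm h"
    using smooth_compact_support_derivative_bound[OF f] by metis
  have "emeasure lborel ?K < \<infinity>"
    by (intro emeasure_bounded_finite compact_imp_bounded f)
  then have iK: "integrable lborel (indicator ?K :: 'a \<Rightarrow> real)"
    by (intro integrable_real_indicator) auto
  have "integrable lborel (\<lambda>x. indicator ?K x * f x)"
    by (rule integrable_mult_bounded[OF iK]) (use m P in auto)
  moreover have "(\<lambda>x. indicator ?K x * f x) = f"
    by (rule ext) (metis indicator_simps mult_1 mult_zero_left z(1))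
  ultimately show "integrable lborel f" by simp
  have "integrable lborel (\<lambda>x. indicator ?K x * frechet_derivative f (at x) h)"
    by (rule integrable_mult_bounded[OF iK]) (use m L in auto)
  moreover have "(\<lambda>x. indicator ?K x * frechet_derivative f (at x) h) = (\<lambda>x. frechet_derivative f (at x) h)"
    by (rule ext) (metis indicator_simps mult_1 mult_zero_left z(2))
  ultimately show "integrable lborel (\<lambda>x. frechet_derivative f (at x) h)" by simp
qed

text \<open>All rests on the normalising integral being nonzero; otherwise the quotient would be the
  zero function by the convention for division by 0. The bump is positive on a ball, and a nonempty
  open set is not negligible.\<close>

lemma mollifier_props:
  assumes r: "0 < r"
  shows mollifier_nonneg: "0 \<le> mollifier r (x :: 'a::euclidean_space)"
    and mollifier_zero: "r \<le> norm x \<Longrightarrow> mollifier r x = 0"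
    and mollifier_compact_support: "compact (closure {x :: 'a. mollifier r x \<noteq> 0})"
    and mollifier_integral: "(\<integral>x. mollifier r x \<partial>(lborel :: 'a measure)) = 1"
proof -
  let ?I = "\<integral>x. bump r x \<partial>(lborel :: 'a measure)"
  have z: "bump r x = 0" if "r \<le> norm x" for x :: 'a
    using bump_pos_iff[OF r, of x] that by linarith
  have s: "smooth_on UNIV (bump r :: 'a \<Rightarrow> real)"
    using smooth_alg_smooth_on[OF bump_smooth_alg[of r 0]] by (simp add: bump_def[abs_def])
  have "compact (closure {x :: 'a. bump r x \<noteq> 0})"
  proof (rule compact_closure_support)
    show "x \<in> cball 0 r" if "bump r x \<noteq> 0" for x :: 'a
      using z[of x] that by (cases "r \<le> norm x") auto
  qed
  note facts = smooth_compact_support_facts[OF s this]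
  have "?I \<noteq> 0"
  proof
    assume "?I = 0"
    then have "AE x in lborel. bump r (x::'a) = 0"
      using facts bump_pos_iff[OF r] by (subst (asm) integral_nonneg_eq_0_iff_AE) auto
    then have "AE x in lborel. x \<notin> ball (0::'a) r"
      by eventually_elim (use bump_pos_iff(1)[OF r] in force)
    then have "ball (0::'a) r \<in> null_sets lborel"
      by (subst AE_iff_null_sets) auto
    then have "negligible (ball (0::'a) r)"
      by (simp add: negligible_iff_null_sets null_sets_completionI)
    then show False using open_not_negligible[of "ball (0::'a) r"] r by simp
  qed
  moreover have "?I \<ge> 0" using bump_pos_iff(2)[OF r] by (intro integral_nonneg_AE) auto
  ultimately have I: "?I > 0" by linarith
  show "0 \<le> mollifier r x" for x :: 'a
    unfolding mollifier_def by (rule divide_nonneg_pos[OF bump_pos_iff(2)[OF r] I])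
  show z': "mollifier r x = 0" if "r \<le> norm x" for x :: 'a
    using z[OF that] by (simp add: mollifier_def)
  show "compact (closure {x :: 'a. mollifier r x \<noteq> 0})"
  proof (rule compact_closure_support)
    show "x \<in> cball 0 r" if "mollifier r x \<noteq> 0" for x :: 'a
      using z'[of x] that by (cases "r \<le> norm x") auto
  qed
  show "(\<integral>x. mollifier r x \<partial>(lborel :: 'a measure)) = 1"
    using I by (simp add: mollifier_def)
qed

lemma test_function_mollifier:
  fixes x :: "'a::euclidean_space"
  assumes "0 < r" "cball x r \<subseteq> \<Omega>"
  shows "test_function \<Omega> (\<lambda>y. mollifier r (x - y))"
proof -
  have s: "y \<in> cball x r" if "mollifier r (x - y) \<noteq> 0" for y
    using mollifier_zero[OF assms(1), of "x - y"] that by (cases "r \<le> norm (x - y)") (auto simp: dist_norm)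
  note c = compact_closure_support[of "\<lambda>y. mollifier r (x - y)", OF s]
  show ?thesis
    unfolding test_function_def
    using mollifier_smooth_on[of r x] c(1) order_trans[OF c(2) assms(2)] by (intro conjI)
qed

lemma mollify_L1:
  fixes f :: "'a::euclidean_space \<Rightarrow> real"
  assumes f: "integrable lborel f"
  shows "integrable lborel (\<lambda>x. convolve f (mollifier (1 / real (Suc n))) x - f x)"
    and "(\<lambda>n. \<integral>x. \<bar>convolve f (mollifier (1 / real (Suc n))) x - f x\<bar> \<partial>lborel) \<longlonglongrightarrow> 0"
proof -
  let ?\<eta> = "\<lambda>n. mollifier (1 / real (Suc n)) :: 'a \<Rightarrow> real"
  have \<eta>: "integrable lborel (?\<eta> n)" "\<exists>C. \<forall>z. ?\<eta> n z \<le> C" for n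
  proof -
    have "0 < 1 / real (Suc n)" by simp
    note facts = smooth_compact_support_facts[OF mollifier_smooth_on' mollifier_compact_support[OF this]]
    show "integrable lborel (?\<eta> n)" by (rule facts(3))
    show "\<exists>C. \<forall>z. ?\<eta> n z \<le> C" using facts(5) by (meson abs_le_D1)
  qed
  have *: "integrable lborel (\<lambda>x. convolve f (?\<eta> n) x - f x)
      \<and> (\<integral>x. \<bar>convolve f (?\<eta> n) x - f x\<bar> \<partial>lborel) \<le> e"
    if "0 \<le> e" "\<And>z. norm z < 1 / real (Suc n) \<Longrightarrow> (\<integral>x. \<bar>f (z + x) - f x\<bar> \<partial>lborel) \<le> e" for n e
  proof -
    obtain C where C: "\<And>z. ?\<eta> n z \<le> C" using \<eta>(2) by blast
    show ?thesis
      using convolve_L1_approx[OF f \<eta>(1) mollifier_nonneg C mollifier_integral mollifier_zero that]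
      by simp
  qed
  \<comment> \<open>This crude bound holds for translations of any length, so it gives integrability
    for every n, before any smallness is known.\<close>
  have "(\<integral>x. \<bar>f (z + x) - f x\<bar> \<partial>lborel) \<le> 2 * (\<integral>x. \<bar>f x\<bar> \<partial>lborel)" for z
  proof -
    have i: "integrable lborel (\<lambda>x. f (z + x))" using f by (simp add: lborel_integral_translate(2))
    have "(\<integral>x. \<bar>f (z + x) - f x\<bar> \<partial>lborel) \<le> (\<integral>x. \<bar>f (z + x)\<bar> + \<bar>f x\<bar> \<partial>lborel)"
      using i f by (intro integral_mono) auto
    also have "\<dots> = 2 * (\<integral>x. \<bar>f x\<bar> \<partial>lborel)"
      using i f lborel_integral_translate(1)[of "\<lambda>x. \<bar>f x\<bar>" z]
      by (subst Bochner_Integration.integral_add) auto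
    finally show ?thesis .
  qed
  then show "integrable lborel (\<lambda>x. convolve f (mollifier (1 / real (Suc n))) x - f x)"
    using *[of "2 * (\<integral>x. \<bar>f x\<bar> \<partial>lborel)" n] by simp
  show "(\<lambda>n. \<integral>x. \<bar>convolve f (?\<eta> n) x - f x\<bar> \<partial>lborel) \<longlonglongrightarrow> 0"
  proof (rule LIMSEQ_I)
    fix e :: real assume e: "0 < e"
    then obtain d where d: "d > 0" "\<And>z. norm z < d \<Longrightarrow> (\<integral>x. \<bar>f (z + x) - f x\<bar> \<partial>lborel) < e/2"
      using L1_translation_continuous[OF f, of "e/2"] by auto
    obtain N where N: "1 / real (Suc N) < d" using nat_approx_posE[OF d(1)] by blast
    have "norm ((\<integral>x. \<bar>convolve f (?\<eta> n) x - f x\<bar> \<partial>lborel) - 0) < e" if "N \<le> n" for n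
    proof -
      have "1 / real (Suc n) \<le> 1 / real (Suc N)" using that by (simp add: divide_simps)
      then have "norm z < 1 / real (Suc n) \<Longrightarrow> (\<integral>x. \<bar>f (z + x) - f x\<bar> \<partial>lborel) \<le> e/2" for z
        using d(2)[of z] N by linarith
      then have "(\<integral>x. \<bar>convolve f (?\<eta> n) x - f x\<bar> \<partial>lborel) \<le> e/2"
        using *[of "e/2" n] e by (meson half_gt_zero less_imp_le)
      then show ?thesis using e by simp
    qed
    then show "\<exists>no. \<forall>n\<ge>no. norm ((\<integral>x. \<bar>convolve f (?\<eta> n) x - f x\<bar> \<partial>lborel) - 0) < e" by blast
  qed
qed

text \<open>L1 convergence yields almost everywhere convergence along a subsequence; this takes the
  place of an argument with Lebesgue points.\<close>

lemma mollify_AE_subseq: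
  fixes f :: "'a::euclidean_space \<Rightarrow> real"
  assumes f: "integrable lborel f"
  obtains s :: "nat \<Rightarrow> nat" where "strict_mono s"
    and "AE x in lborel. (\<lambda>n. convolve f (mollifier (1 / real (Suc (s n)))) x) \<longlonglongrightarrow> f x"
proof -
  obtain s :: "nat \<Rightarrow> nat" where s: "strict_mono s"
    "AE x in lborel. (\<lambda>n. convolve f (mollifier (1 / real (Suc (s n)))) x - f x) \<longlonglongrightarrow> 0"
    using tendsto_L1_AE_subseq[of lborel "\<lambda>n x. convolve f (mollifier (1 / real (Suc n))) x - f x",
        OF mollify_L1(1)[OF f]] mollify_L1(2)[OF f] unfolding real_norm_def by blast
  from s(2) have "AE x in lborel. (\<lambda>n. convolve f (mollifier (1 / real (Suc (s n)))) x) \<longlonglongrightarrow> f x"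
    by eventually_elim (simp add: LIM_zero_iff)
  with s(1) show ?thesis by (rule that)
qed

text \<open>U and G live on the whole space so that they can be convolved, but the identity is
  tested only inside \<Omega>: the extension of an H1 function by zero need not be weakly
  differentiable across the boundary.\<close>

definition weak_partial :: "'a::euclidean_space set \<Rightarrow> 'a \<Rightarrow> ('a \<Rightarrow> real) \<Rightarrow> ('a \<Rightarrow> real) \<Rightarrow> bool" where
  "weak_partial \<Omega> b U G \<longleftrightarrow> integrable lborel U \<and> integrable lborel G \<and>
     (\<forall>\<phi>. test_function \<Omega> \<phi> \<longrightarrow>
        (\<integral>x. U x * frechet_derivative \<phi> (at x) b \<partial>lborel) = - (\<integral>x. G x * \<phi> x \<partial>lborel))"

text \<open>The function \<open>\<lambda>y. mollifier r (x - y)\<close> is a test function as soon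
  as the closed ball around x lies in \<Omega>. The sign from differentiating in y instead of x
  cancels the sign in the definition of the weak derivative.\<close>

lemma convolve_weak_partial:
  fixes x :: "'a::euclidean_space"
  assumes w: "weak_partial \<Omega> b U G" and r: "0 < r" "cball x r \<subseteq> \<Omega>"
  shows "convolve U (\<lambda>z. frechet_derivative (mollifier r) (at z) b) x = convolve G (mollifier r) x"
proof -
  let ?\<eta>' = "\<lambda>z::'a. frechet_derivative (mollifier r) (at z)"
  have d: "frechet_derivative (\<lambda>y. mollifier r (x - y)) (at y) b = - ?\<eta>' (x - y) b" for y
  proof -
    have \<eta>: "(mollifier r has_derivative ?\<eta>' (x - y)) (at (x - y))"
      by (rule smooth_on_UNIV_has_derivative[OF mollifier_smooth_on'])
    have "((\<lambda>y. x - y) has_derivative (\<lambda>h. - h)) (at y)"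
      by (auto intro!: derivative_eq_intros)
    from has_derivative_compose[OF this \<eta>]
    have "frechet_derivative (\<lambda>y. mollifier r (x - y)) (at y) = (\<lambda>h. ?\<eta>' (x - y) (- h))"
      by (metis frechet_derivative_at)
    then show ?thesis
      using linear_neg[OF has_derivative_linear[OF \<eta>]] by simp
  qed
  have "(\<integral>y. U y * frechet_derivative (\<lambda>y. mollifier r (x - y)) (at y) b \<partial>lborel)
      = - (\<integral>y. G y * mollifier r (x - y) \<partial>lborel)"
    using w test_function_mollifier[OF r] by (simp add: weak_partial_def)
  then show ?thesis by (simp add: d convolve_def)
qed

lemma tendsto_inverse_Suc_subseq:
  assumes "strict_mono s" "0 < d"
  shows "\<forall>\<^sub>F n in sequentially. 1 / real (Suc (s n)) < d"
proof -
  have "(\<lambda>n. 1 / real (Suc n)) \<longlonglongrightarrow> 0"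
    using LIMSEQ_Suc[OF lim_1_over_n[where 'a=real]] by simp
  from LIMSEQ_subseq_LIMSEQ[OF this assms(1)] show ?thesis
    using order_tendstoD(2)[of _ 0 sequentially d] assms(2) by (simp add: comp_def)
qed

text \<open>Mollifications at small radius have zero gradient on small balls, hence are constant
  there. Their limit is therefore locally constant, and connectedness does the rest.\<close>

lemma weak_partial_zero_imp_const:
  fixes \<Omega> :: "'a::euclidean_space set"
  assumes "open \<Omega>" "connected \<Omega>" and w: "\<And>b. b \<in> Basis \<Longrightarrow> weak_partial \<Omega> b U (\<lambda>_. 0)"
  shows "\<exists>c. AE x in lborel. x \<in> \<Omega> \<longrightarrow> U x = c"
proof -
  have U: "integrable lborel U"
    using w[of "SOME b. b \<in> Basis"] by (simp add: weak_partial_def some_in_eq)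
  obtain s :: "nat \<Rightarrow> nat" where s: "strict_mono s"
    "AE x in lborel. (\<lambda>n. convolve U (mollifier (1 / real (Suc (s n)))) x) \<longlonglongrightarrow> U x"
    by (rule mollify_AE_subseq[OF U])
  define V where "V n = convolve U (mollifier (1 / real (Suc (s n))))" for n
  \<comment> \<open>\<open>lim\<close> is a definite description with some value even where the
    sequence diverges. Eventually equal sequences share this value, so no exceptional null set
    disturbs the connectedness argument.\<close>
  have loc: "\<forall>\<^sub>F y in at x within \<Omega>. lim (\<lambda>n. V n x) = lim (\<lambda>n. V n y)" if x: "x \<in> \<Omega>" for x
  proof -
    obtain d where d: "0 < d" "ball x d \<subseteq> \<Omega>" using \<open>open \<Omega>\<close> x open_contains_ball by blast
    \<comment> \<open>Half of the radius d is reserved for the support of the mollifier.\<close>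
    have "lim (\<lambda>n. V n x) = lim (\<lambda>n. V n y)" if y: "y \<in> ball x (d/2)" for y
    proof -
      have "\<forall>\<^sub>F n in sequentially. V n x = V n y"
        using tendsto_inverse_Suc_subseq[OF s(1) half_gt_zero[OF d(1)]]
      proof eventually_elim
        case (elim n)
        let ?r = "1 / real (Suc (s n))"
        have "(V n has_derivative (\<lambda>h. 0)) (at z within ball x (d/2))" if z: "z \<in> ball x (d/2)" for z
        proof -
          let ?D = "\<lambda>h. convolve U (\<lambda>z. frechet_derivative (mollifier ?r) (at z) h) z"
          have cz: "cball z ?r \<subseteq> \<Omega>"
          proof
            fix v assume "v \<in> cball z ?r"
            then have "dist z v < d/2" "dist x z < d/2" using z elim(1) by auto
            then have "dist x v < d" using dist_triangle[of x v z] by linarith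
            then show "v \<in> \<Omega>" using d(2) by (meson mem_ball subsetD)
          qed
          have der: "(V n has_derivative ?D) (at z)"
            unfolding V_def
            by (rule convolve_has_derivative[OF U mollifier_smooth_on' mollifier_compact_support]) simp
          have "?D b = 0" if "b \<in> Basis" for b
            using convolve_weak_partial[OF w[OF that] _ cz] by (simp add: convolve_def)
          moreover have "linear ?D" using der by (rule has_derivative_linear)
          ultimately have "?D = (\<lambda>h. 0)"
            by (intro linear_eq_stdbasis) (auto simp: linear_iff)
          with der show ?thesis by (simp add: has_derivative_at_withinI)
        qed
        then have "\<exists>c. \<forall>z\<in>ball x (d/2). V n z = c"
          by (intro has_derivative_zero_constant) auto
        then show ?case using y d(1) by auto
      qed
      then have "(\<lambda>n. V n x) \<longlonglongrightarrow> l \<longleftrightarrow> (\<lambda>n. V n y) \<longlonglongrightarrow> l" for l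
        by (rule tendsto_cong)
      then show ?thesis by (simp add: lim_def)
    qed
    then show ?thesis
      using d(1) by (auto simp: eventually_at dist_commute intro!: exI[of _ "d/2"])
  qed
  show ?thesis
  proof (cases "\<Omega> = {}")
    case False
    then obtain a where a: "a \<in> \<Omega>" by blast
    have "lim (\<lambda>n. V n x) = lim (\<lambda>n. V n a)" if "x \<in> \<Omega>" for x
      by (rule connected_local_const[OF assms(2) that a]) (use loc in auto)
    moreover have "AE x in lborel. lim (\<lambda>n. V n x) = U x"
      using s(2) by eventually_elim (auto simp: V_def intro: limI)
    ultimately have "AE x in lborel. x \<in> \<Omega> \<longrightarrow> U x = lim (\<lambda>n. V n a)"
      by auto
    then show ?thesis by blast
  qed auto
qed

text \<open>The fundamental lemma of the calculus of variations. The mollification of f at x is f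
  integrated against a test function once the radius is small, hence 0; along a subsequence it
  converges to f almost everywhere.\<close>

lemma test_function_integral_zero_imp_AE_zero:
  fixes \<Omega> :: "'a::euclidean_space set"
  assumes "open \<Omega>" and f: "integrable lborel f"
    and z: "\<And>\<phi>. test_function \<Omega> \<phi> \<Longrightarrow> (\<integral>x. f x * \<phi> x \<partial>lborel) = 0"
  shows "AE x in lborel. x \<in> \<Omega> \<longrightarrow> f x = 0"
proof -
  obtain s :: "nat \<Rightarrow> nat" where s: "strict_mono s"
    "AE x in lborel. (\<lambda>n. convolve f (mollifier (1 / real (Suc (s n)))) x) \<longlonglongrightarrow> f x"
    by (rule mollify_AE_subseq[OF f])
  from s(2) show ?thesis
  proof (eventually_elim, intro impI)
    fix x assume lim: "(\<lambda>n. convolve f (mollifier (1 / real (Suc (s n)))) x) \<longlonglongrightarrow> f x" and x: "x \<in> \<Omega>"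
    obtain d where d: "0 < d" "cball x d \<subseteq> \<Omega>" using \<open>open \<Omega>\<close> x open_contains_cball by blast
    have "\<forall>\<^sub>F n in sequentially. convolve f (mollifier (1 / real (Suc (s n)))) x = 0"
      using tendsto_inverse_Suc_subseq[OF s(1) d(1)]
    proof eventually_elim
      case (elim n)
      then have "cball x (1 / real (Suc (s n))) \<subseteq> \<Omega>"
        using d(2) by (meson less_imp_le order_trans subset_cball)
      then show ?case
        unfolding convolve_def by (intro z test_function_mollifier) auto
    qed
    then have "(\<lambda>n. convolve f (mollifier (1 / real (Suc (s n)))) x) \<longlonglongrightarrow> 0"
      by (rule tendsto_eventually)
    with lim show "f x = 0" by (rule LIMSEQ_unique)
  qed
qed

section \<open>The chain rule for weak derivatives\<close>

lemma has_derivative_along_line: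
  fixes f :: "'a::real_normed_vector \<Rightarrow> real"
  assumes "(f has_derivative f') (at x)"
  shows "((\<lambda>t. f (x + t *\<^sub>R b)) has_real_derivative f' b) (at 0)"
proof -
  have "((\<lambda>t. x + t *\<^sub>R b) has_derivative (\<lambda>t. t *\<^sub>R b)) (at 0)"
    by (auto intro!: derivative_eq_intros)
  moreover have "(f has_derivative f') (at (x + 0 *\<^sub>R b))" using assms by simp
  ultimately have "((\<lambda>t. f (x + t *\<^sub>R b)) has_derivative (\<lambda>t. f' (t *\<^sub>R b))) (at 0)"
    by (rule has_derivative_compose)
  moreover have "f' (t *\<^sub>R b) = f' b * t" for t
    using linear_scale[OF has_derivative_linear[OF assms], of t b] by simp
  ultimately show ?thesis by (simp add: has_field_derivative_def)
qed

lemma test_function_facts: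
  assumes "test_function \<Omega> \<phi>"
  shows "smooth_on UNIV \<phi>" and "compact (closure {x. \<phi> x \<noteq> 0})" and "closure {x. \<phi> x \<noteq> 0} \<subseteq> \<Omega>"
    and "x \<notin> \<Omega> \<Longrightarrow> \<phi> x = 0" and "x \<notin> \<Omega> \<Longrightarrow> frechet_derivative \<phi> (at x) h = 0"
    and "bounded {x. \<phi> x \<noteq> 0}"
proof -
  show *: "smooth_on UNIV \<phi>" "compact (closure {x. \<phi> x \<noteq> 0})" "closure {x. \<phi> x \<noteq> 0} \<subseteq> \<Omega>"
    using assms by (auto simp: test_function_def)
  show "\<phi> x = 0" if "x \<notin> \<Omega>"
    using *(3) that closure_subset[of "{x. \<phi> x \<noteq> 0}"] by blast
  show "frechet_derivative \<phi> (at x) h = 0" if "x \<notin> \<Omega>"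
  proof -
    have "x \<notin> closure {x. \<phi> x \<noteq> 0}" using *(3) that by blast
    then show ?thesis by (simp add: frechet_derivative_zero_outside_support)
  qed
  show "bounded {x. \<phi> x \<noteq> 0}"
    using *(2) by (meson bounded_subset closure_subset compact_imp_bounded)
qed

text \<open>The mollified U is differentiable everywhere, so the classical product and chain rules
  apply to F of it times \<phi>, and the integral of the derivative in direction b vanishes. On the
  support of \<phi> the derivative of the mollified U is the mollified G.\<close>

lemma chain_rule_mollified:
  fixes \<Omega> :: "'a::euclidean_space set"
  assumes w: "weak_partial \<Omega> b U G"
    and F: "\<And>s. (F has_real_derivative F' s) (at s)" "continuous_on UNIV F'"
      "\<And>s. \<bar>F s\<bar> \<le> B" "\<And>s. \<bar>F' s\<bar> \<le> L"
    and \<phi>: "test_function \<Omega> \<phi>"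
    and r: "0 < r" "\<And>x. x \<in> closure {x. \<phi> x \<noteq> 0} \<Longrightarrow> cball x r \<subseteq> \<Omega>"
    and Gr: "integrable lborel (convolve G (mollifier r))"
  shows "(\<integral>x. F (convolve U (mollifier r) x) * frechet_derivative \<phi> (at x) b \<partial>lborel)
      = - (\<integral>x. F' (convolve U (mollifier r) x) * convolve G (mollifier r) x * \<phi> x \<partial>lborel)"
proof -
  let ?\<phi>' = "\<lambda>x. frechet_derivative \<phi> (at x)"
  let ?\<eta>' = "\<lambda>z::'a. frechet_derivative (mollifier r) (at z)"
  define V where "V = convolve U (mollifier r)"
  define V' where "V' x = convolve U (\<lambda>z. ?\<eta>' z b) x" for x
  define Gc where "Gc = convolve G (mollifier r)"
  note t = test_function_facts[OF \<phi>]
  note f = smooth_compact_support_facts[OF t(1,2)]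
  have U: "integrable lborel U" and G: "integrable lborel G" using w by (auto simp: weak_partial_def)
  have dV: "(V has_derivative (\<lambda>h. convolve U (\<lambda>z. ?\<eta>' z h) x)) (at x)" for x
    unfolding V_def by (rule convolve_has_derivative[OF U mollifier_smooth_on' mollifier_compact_support[OF r(1)]])
  have V': "V' x = Gc x" if "\<phi> x \<noteq> 0" for x
  proof -
    have "x \<in> closure {x. \<phi> x \<noteq> 0}" using that closure_subset[of "{x. \<phi> x \<noteq> 0}"] by blast
    then show ?thesis
      unfolding V'_def Gc_def by (intro convolve_weak_partial[OF w r(1) r(2)])
  qed
  have contV: "continuous_on UNIV V"
    using has_derivative_continuous[OF dV] by (simp add: continuous_on_eq_continuous_at)
  have contF: "continuous_on UNIV F"
    using DERIV_isCont[OF F(1)] by (simp add: continuous_on_eq_continuous_at)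
  have [measurable]: "V \<in> borel_measurable borel" "F \<in> borel_measurable borel" "F' \<in> borel_measurable borel"
    using contV contF F(2) by (auto intro: borel_measurable_continuous_onI)
  have [measurable]: "\<phi> \<in> borel_measurable borel" "(\<lambda>x. ?\<phi>' x b) \<in> borel_measurable borel"
    by (rule f)+
  have [measurable]: "Gc \<in> borel_measurable borel" using Gr by (auto simp: Gc_def)
  obtain P where P: "\<And>x. \<bar>\<phi> x\<bar> \<le> P" using f(5) by blast
  obtain L1 where L1: "\<And>x h. \<bar>?\<phi>' x h\<bar> \<le> L1 * norm h"
    using smooth_compact_support_derivative_bound[OF t(1,2)] by metis
  obtain L2 where L2: "0 \<le> L2" "\<And>x h. \<bar>?\<eta>' x h\<bar> \<le> L2 * norm h"
    using smooth_compact_support_derivative_bound[OF mollifier_smooth_on' mollifier_compact_support[OF r(1)]] by metis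
  have [measurable]: "(\<lambda>z. ?\<eta>' z b) \<in> borel_measurable borel"
    by (intro borel_measurable_continuous_onI smooth_on_UNIV_derivative_continuous mollifier_smooth_on')
  \<comment> \<open>The bound depends on r through \<open>L2\<close>; this is harmless because r is
    fixed and only some global bound on the derivative is asked for.\<close>
  have V'b: "\<bar>V' x\<bar> \<le> (\<integral>y. \<bar>U y\<bar> \<partial>lborel) * (L2 * norm b)" for x
  proof -
    have "\<bar>V' x\<bar> \<le> (\<integral>y. \<bar>U y * ?\<eta>' (x - y) b\<bar> \<partial>lborel)"
      unfolding V'_def convolve_def by (rule integral_abs_bound)
    also have "\<dots> \<le> (\<integral>y. \<bar>U y\<bar> * (L2 * norm b) \<partial>lborel)"
      using U L2 by (intro integral_mono integrable_abs integrable_mult_bounded[where C="L2 * norm b"])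
        (auto simp: abs_mult intro!: mult_left_mono)
    finally show ?thesis by simp
  qed
  have B0: "0 \<le> B" "0 \<le> L" "0 \<le> P"
    using F(3)[of 0] F(4)[of 0] P[of 0] by linarith+
  have "(\<integral>x. F' (V x) * V' x * \<phi> x + F (V x) * ?\<phi>' x b \<partial>lborel) = 0"
  proof (rule integral_directional_derivative_zero)
    show "(\<lambda>x. F (V x) * \<phi> x) \<in> borel_measurable borel" by measurable
    show "bounded {x. F (V x) * \<phi> x \<noteq> 0}"
      by (rule bounded_subset[OF t(6)]) auto
    show "\<bar>F (V x) * \<phi> x\<bar> \<le> B * P" for x
      unfolding abs_mult by (intro mult_mono F P B0) auto
    show "\<bar>F' (V x) * V' x * \<phi> x + F (V x) * ?\<phi>' x b\<bar>
        \<le> L * ((\<integral>y. \<bar>U y\<bar> \<partial>lborel) * (L2 * norm b)) * P + B * (L1 * norm b)" for x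
    proof -
      have "\<bar>F' (V x) * V' x * \<phi> x\<bar> \<le> L * ((\<integral>y. \<bar>U y\<bar> \<partial>lborel) * (L2 * norm b)) * P"
        unfolding abs_mult using L2(1) by (intro mult_mono F P B0 V'b mult_nonneg_nonneg) auto
      moreover have "\<bar>F (V x) * ?\<phi>' x b\<bar> \<le> B * (L1 * norm b)"
        unfolding abs_mult by (intro mult_mono F L1 B0) auto
      ultimately show ?thesis by linarith
    qed
    show "((\<lambda>t. F (V (x + t *\<^sub>R b)) * \<phi> (x + t *\<^sub>R b)) has_real_derivative
        F' (V x) * V' x * \<phi> x + F (V x) * ?\<phi>' x b) (at 0)" for x
    proof -
      have 1: "((\<lambda>t. V (x + t *\<^sub>R b)) has_real_derivative V' x) (at 0)"
        using has_derivative_along_line[OF dV] by (simp add: V'_def)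
      have 2: "((\<lambda>t. \<phi> (x + t *\<^sub>R b)) has_real_derivative ?\<phi>' x b) (at 0)"
        by (rule has_derivative_along_line[OF smooth_on_UNIV_has_derivative[OF t(1)]])
      have 3: "((\<lambda>t. F (V (x + t *\<^sub>R b))) has_real_derivative F' (V x) * V' x) (at 0)"
        using DERIV_chain2[OF F(1) 1] by simp
      show ?thesis using DERIV_mult[OF 3 2] by (simp add: algebra_simps)
    qed
  qed
  \<comment> \<open>\<open>V'\<close> and \<open>Gc\<close> are known to agree only where \<phi> is
    nonzero; elsewhere the factor \<phi> removes both.\<close>
  also have "(\<lambda>x. F' (V x) * V' x * \<phi> x + F (V x) * ?\<phi>' x b)
      = (\<lambda>x. F' (V x) * Gc x * \<phi> x + F (V x) * ?\<phi>' x b)"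
    by (rule ext) (metis V' mult_zero_right)
  finally have *: "(\<integral>x. F' (V x) * Gc x * \<phi> x + F (V x) * ?\<phi>' x b \<partial>lborel) = 0" .
  have i1: "integrable lborel (\<lambda>x. F' (V x) * Gc x * \<phi> x)"
  proof -
    have "integrable lborel (\<lambda>x. Gc x * (F' (V x) * \<phi> x))"
      using Gr unfolding Gc_def[symmetric]
      by (rule integrable_mult_bounded[where C="L * P"]) (auto simp: abs_mult intro!: mult_mono F P B0)
    then show ?thesis by (simp add: algebra_simps)
  qed
  have "integrable lborel (\<lambda>x. ?\<phi>' x b * F (V x))"
    by (rule integrable_mult_bounded[OF f(4), where C=B]) (auto intro: F)
  then have i2: "integrable lborel (\<lambda>x. F (V x) * ?\<phi>' x b)" by (simp add: mult.commute)
  show ?thesis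
    using * i1 i2 unfolding V_def[symmetric] Gc_def[symmetric] by simp
qed

text \<open>Let the radius in \<open>chain_rule_mollified\<close> tend to 0. The left side converges
  by dominated convergence because F is bounded. On the right only L1 convergence of the mollified G
  is used: it is split into G, again by dominated convergence, and an error that is small in L1 and
  multiplied by a bounded factor.\<close>

lemma weak_partial_chain_rule:
  fixes \<Omega> :: "'a::euclidean_space set"
  assumes "open \<Omega>" and w: "weak_partial \<Omega> b U G"
    and F: "\<And>s. (F has_real_derivative F' s) (at s)" "continuous_on UNIV F'"
      "\<And>s. \<bar>F s\<bar> \<le> B" "\<And>s. \<bar>F' s\<bar> \<le> L"
    and \<phi>: "test_function \<Omega> \<phi>"
  shows "(\<integral>x. F (U x) * frechet_derivative \<phi> (at x) b \<partial>lborel)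
      = - (\<integral>x. F' (U x) * G x * \<phi> x \<partial>lborel)"
proof -
  let ?\<phi>' = "\<lambda>x. frechet_derivative \<phi> (at x)"
  note t = test_function_facts[OF \<phi>]
  note f = smooth_compact_support_facts[OF t(1,2)]
  have U: "integrable lborel U" and G: "integrable lborel G" using w by (auto simp: weak_partial_def)
  obtain s :: "nat \<Rightarrow> nat" where s: "strict_mono s"
    "AE x in lborel. (\<lambda>n. convolve U (mollifier (1 / real (Suc (s n)))) x) \<longlonglongrightarrow> U x"
    by (rule mollify_AE_subseq[OF U])
  define V where "V n = convolve U (mollifier (1 / real (Suc (s n))))" for n
  define H where "H n = convolve G (mollifier (1 / real (Suc (s n))))" for n
  have lim: "AE x in lborel. (\<lambda>n. V n x) \<longlonglongrightarrow> U x" using s(2) by (simp add: V_def)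
  have [measurable]: "U \<in> borel_measurable borel" "G \<in> borel_measurable borel" using U G by auto
  have mol: "mollifier r \<in> borel_measurable borel" for r
    by (intro borel_measurable_continuous_onI smooth_on_UNIV_continuous mollifier_smooth_on')
  have [measurable]: "V n \<in> borel_measurable borel" "H n \<in> borel_measurable borel" for n
    unfolding V_def H_def by (intro convolve_measurable mol; simp)+
  have contF: "continuous_on UNIV F"
    using DERIV_isCont[OF F(1)] by (simp add: continuous_on_eq_continuous_at)
  have [measurable]: "F \<in> borel_measurable borel" "F' \<in> borel_measurable borel"
    using contF F(2) by (auto intro: borel_measurable_continuous_onI)
  have [measurable]: "\<phi> \<in> borel_measurable borel" "(\<lambda>x. ?\<phi>' x b) \<in> borel_measurable borel"
    by (rule f)+
  obtain P where P: "\<And>x. \<bar>\<phi> x\<bar> \<le> P" using f(5) by blast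
  have B0: "0 \<le> B" "0 \<le> L" "0 \<le> P"
    using F(3)[of 0] F(4)[of 0] P[of 0] by linarith+
  have iHG: "integrable lborel (\<lambda>x. H n x - G x)" for n
    unfolding H_def by (rule mollify_L1(1)[OF G])
  have H: "integrable lborel (H n)" for n
    using Bochner_Integration.integrable_add[OF iHG[of n] G] by simp
  have "(\<lambda>n. \<integral>x. \<bar>convolve G (mollifier (1 / real (Suc n))) x - G x\<bar> \<partial>lborel) \<longlonglongrightarrow> 0"
    by (rule mollify_L1(2)[OF G])
  from LIMSEQ_subseq_LIMSEQ[OF this s(1)]
  have HG: "(\<lambda>n. \<integral>x. \<bar>H n x - G x\<bar> \<partial>lborel) \<longlonglongrightarrow> 0"
    by (simp add: H_def comp_def)
  \<comment> \<open>The compact support of \<phi> keeps a positive distance from the complement of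
    \<Omega>; the mollified identity holds for all radii below it.\<close>
  obtain d where d: "0 < d" "(\<Union>x\<in>closure {x. \<phi> x \<noteq> 0}. cball x d) \<subseteq> \<Omega>"
    using compact_subset_open_imp_cball_epsilon_subset[OF t(2) \<open>open \<Omega>\<close> t(3)] by blast
  have ev: "\<forall>\<^sub>F n in sequentially. (\<integral>x. F (V n x) * ?\<phi>' x b \<partial>lborel)
      = - (\<integral>x. F' (V n x) * H n x * \<phi> x \<partial>lborel)"
    using tendsto_inverse_Suc_subseq[OF s(1) d(1)]
  proof eventually_elim
    case (elim n)
    have "cball x (1 / real (Suc (s n))) \<subseteq> \<Omega>" if "x \<in> closure {x. \<phi> x \<noteq> 0}" for x
    proof -
      have "cball x (1 / real (Suc (s n))) \<subseteq> cball x d" using elim by (intro subset_cball) simp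
      also have "\<dots> \<subseteq> \<Omega>" using d(2) that by blast
      finally show ?thesis .
    qed
    then show ?case
      unfolding V_def H_def using H[of n]
      by (intro chain_rule_mollified[OF w F \<phi>]) (auto simp: H_def)
  qed
  have lim1: "(\<lambda>n. \<integral>x. F (V n x) * ?\<phi>' x b \<partial>lborel) \<longlonglongrightarrow> (\<integral>x. F (U x) * ?\<phi>' x b \<partial>lborel)"
  proof (rule integral_dominated_convergence[where w="\<lambda>x. B * \<bar>?\<phi>' x b\<bar>"])
    show "integrable lborel (\<lambda>x. B * \<bar>?\<phi>' x b\<bar>)" using f(4) by auto
    show "AE x in lborel. (\<lambda>n. F (V n x) * ?\<phi>' x b) \<longlonglongrightarrow> F (U x) * ?\<phi>' x b"
      using lim
    proof eventually_elim
      case (elim x)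
      have "isCont F (U x)" using F(1) by (rule DERIV_isCont)
      from isCont_tendsto_compose[OF this elim] show ?case by (intro tendsto_intros)
    qed
    show "AE x in lborel. norm (F (V n x) * ?\<phi>' x b) \<le> B * \<bar>?\<phi>' x b\<bar>" for n
      by (intro AE_I2) (auto simp: abs_mult intro!: mult_right_mono F)
  qed auto
  have lim2: "(\<lambda>n. \<integral>x. F' (V n x) * G x * \<phi> x \<partial>lborel) \<longlonglongrightarrow> (\<integral>x. F' (U x) * G x * \<phi> x \<partial>lborel)"
  proof (rule integral_dominated_convergence[where w="\<lambda>x. L * \<bar>G x\<bar> * P"])
    show "integrable lborel (\<lambda>x. L * \<bar>G x\<bar> * P)" using G by auto
    show "AE x in lborel. (\<lambda>n. F' (V n x) * G x * \<phi> x) \<longlonglongrightarrow> F' (U x) * G x * \<phi> x"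
      using lim
    proof eventually_elim
      case (elim x)
      have "isCont F' (U x)" using F(2) by (simp add: continuous_on_eq_continuous_at)
      from isCont_tendsto_compose[OF this elim] show ?case by (intro tendsto_intros)
    qed
    show "AE x in lborel. norm (F' (V n x) * G x * \<phi> x) \<le> L * \<bar>G x\<bar> * P" for n
      by (intro AE_I2) (auto simp: abs_mult intro!: mult_mono mult_nonneg_nonneg F P B0)
  qed auto
  have i: "integrable lborel (\<lambda>x. h x * (F' (V n x) * \<phi> x))" if "integrable lborel h" for h n
    using that by (rule integrable_mult_bounded[where C="L * P"])
      (auto simp: abs_mult intro!: mult_mono F P B0)
  have lim3: "(\<lambda>n. \<integral>x. (H n x - G x) * (F' (V n x) * \<phi> x) \<partial>lborel) \<longlonglongrightarrow> 0"
  proof (rule Lim_null_comparison)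
    show "\<forall>\<^sub>F n in sequentially. norm (\<integral>x. (H n x - G x) * (F' (V n x) * \<phi> x) \<partial>lborel)
        \<le> (\<integral>x. \<bar>H n x - G x\<bar> \<partial>lborel) * (L * P)"
    proof (intro always_eventually allI)
      fix n
      have "norm (\<integral>x. (H n x - G x) * (F' (V n x) * \<phi> x) \<partial>lborel)
          \<le> (\<integral>x. \<bar>(H n x - G x) * (F' (V n x) * \<phi> x)\<bar> \<partial>lborel)"
        using integral_abs_bound by simp
      also have "\<dots> \<le> (\<integral>x. \<bar>H n x - G x\<bar> * (L * P) \<partial>lborel)"
        using i[OF iHG] iHG by (intro integral_mono integrable_abs)
          (auto simp: abs_mult intro!: mult_left_mono mult_mono F P B0)
      finally show "norm (\<integral>x. (H n x - G x) * (F' (V n x) * \<phi> x) \<partial>lborel)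
          \<le> (\<integral>x. \<bar>H n x - G x\<bar> \<partial>lborel) * (L * P)" by simp
    qed
    show "(\<lambda>n. (\<integral>x. \<bar>H n x - G x\<bar> \<partial>lborel) * (L * P)) \<longlonglongrightarrow> 0"
      using tendsto_mult_right[OF HG, of "L * P"] by simp
  qed
  have "(\<integral>x. F' (V n x) * H n x * \<phi> x \<partial>lborel)
      = (\<integral>x. F' (V n x) * G x * \<phi> x \<partial>lborel) + (\<integral>x. (H n x - G x) * (F' (V n x) * \<phi> x) \<partial>lborel)" for n
  proof -
    have "(\<integral>x. F' (V n x) * H n x * \<phi> x \<partial>lborel)
        = (\<integral>x. G x * (F' (V n x) * \<phi> x) + (H n x - G x) * (F' (V n x) * \<phi> x) \<partial>lborel)"
      by (simp add: algebra_simps)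
    also have "\<dots> = (\<integral>x. G x * (F' (V n x) * \<phi> x) \<partial>lborel) + (\<integral>x. (H n x - G x) * (F' (V n x) * \<phi> x) \<partial>lborel)"
      by (rule Bochner_Integration.integral_add[OF i[OF G] i[OF iHG]])
    finally show ?thesis by (simp add: ac_simps)
  qed
  then have "(\<lambda>n. \<integral>x. F' (V n x) * H n x * \<phi> x \<partial>lborel) \<longlonglongrightarrow> (\<integral>x. F' (U x) * G x * \<phi> x \<partial>lborel)"
    using tendsto_add[OF lim2 lim3] by simp
  from tendsto_minus[OF this] have "(\<lambda>n. \<integral>x. F (V n x) * ?\<phi>' x b \<partial>lborel)
      \<longlonglongrightarrow> - (\<integral>x. F' (U x) * G x * \<phi> x \<partial>lborel)"
    by (rule Lim_transform_eventually) (use ev in eventually_elim, simp)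
  with lim1 show ?thesis by (rule LIMSEQ_unique)
qed

section \<open>Borel representatives extended by zero\<close>

lemma AE_lebesgue_on_iff:
  assumes "open \<Omega>"
  shows "(AE x in lebesgue_on \<Omega>. P x) \<longleftrightarrow> (AE x in lborel. x \<in> \<Omega> \<longrightarrow> P x)"
  using assms by (simp add: AE_restrict_space_iff AE_completion_iff)

text \<open>\<open>H1_on\<close> is stated with the completed measure on \<Omega>, whereas the
  translation and convolution arguments run with Borel functions on the whole space. A Borel
  representative that is 0 outside \<Omega> translates between the two.\<close>

lemma integral_lebesgue_on_borel_version:
  fixes f f0 :: "'a::euclidean_space \<Rightarrow> real"
  assumes \<Omega>: "open \<Omega>" and f: "f \<in> borel_measurable (lebesgue_on \<Omega>)"
    and f0: "f0 \<in> borel_measurable borel" "\<And>x. x \<notin> \<Omega> \<Longrightarrow> f0 x = 0"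
    and eq: "AE x in lborel. x \<in> \<Omega> \<longrightarrow> f x = f0 x"
  shows "(\<integral>x. f x \<partial>lebesgue_on \<Omega>) = (\<integral>x. f0 x \<partial>lborel)"
    and "integrable (lebesgue_on \<Omega>) f \<longleftrightarrow> integrable lborel f0"
proof -
  have m: "(\<lambda>x. indicator \<Omega> x *\<^sub>R f x) \<in> borel_measurable lebesgue"
    using f \<Omega> by (simp add: borel_measurable_restrict_space_iff)
  have m0: "f0 \<in> borel_measurable lebesgue" using f0 by (simp add: measurable_completion)
  have "AE x in lborel. indicator \<Omega> x *\<^sub>R f x = f0 x"
    using eq by eventually_elim (use f0(2) in \<open>auto simp: indicator_def\<close>)
  then have e: "AE x in lebesgue. indicator \<Omega> x *\<^sub>R f x = f0 x" by (rule AE_completion)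
  show "(\<integral>x. f x \<partial>lebesgue_on \<Omega>) = (\<integral>x. f0 x \<partial>lborel)"
    using \<Omega> integral_cong_AE[OF m m0 e] f0(1) by (simp add: integral_restrict_space integral_completion)
  show "integrable (lebesgue_on \<Omega>) f \<longleftrightarrow> integrable lborel f0"
    using \<Omega> integrable_cong_AE[OF m m0 e] f0(1) by (simp add: integrable_restrict_space integrable_completion)
qed

lemma lebesgue_on_borel_version_exists:
  fixes f :: "'a::euclidean_space \<Rightarrow> real"
  assumes \<Omega>: "open \<Omega>" and f: "f \<in> borel_measurable (lebesgue_on \<Omega>)"
  obtains f0 where "f0 \<in> borel_measurable borel" "\<And>x. x \<notin> \<Omega> \<Longrightarrow> f0 x = 0"
    "AE x in lborel. x \<in> \<Omega> \<longrightarrow> f x = f0 x"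
proof -
  have m: "(\<lambda>x. indicator \<Omega> x *\<^sub>R f x) \<in> borel_measurable lebesgue"
    using f \<Omega> by (simp add: borel_measurable_restrict_space_iff)
  then obtain f1 where f1: "f1 \<in> borel_measurable lborel"
    "AE x in lborel. indicator \<Omega> x *\<^sub>R f x = f1 x"
    using completion_ex_borel_measurable_real by blast
  show ?thesis
  proof (rule that[of "\<lambda>x. indicator \<Omega> x * f1 x"])
    show "(\<lambda>x. indicator \<Omega> x * f1 x) \<in> borel_measurable borel" using f1(1) \<Omega> by auto
    show "AE x in lborel. x \<in> \<Omega> \<longrightarrow> f x = indicator \<Omega> x * f1 x"
      using f1(2) by eventually_elim auto
  qed auto
qed

section \<open>The space H1 on a bounded open set\<close>

lemma finite_measure_lebesgue_on_bounded_open: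
  assumes "open \<Omega>" "bounded (\<Omega> :: 'a::euclidean_space set)"
  shows "finite_measure (lebesgue_on \<Omega>)"
  using assms by (intro finite_measure_lebesgue_on bounded_set_imp_lmeasurable) auto

lemma bounded_imp_integrable_lebesgue_on:
  fixes f :: "'a::euclidean_space \<Rightarrow> real"
  assumes "open \<Omega>" "bounded \<Omega>" "f \<in> borel_measurable (lebesgue_on \<Omega>)"
    "AE x in lebesgue_on \<Omega>. \<bar>f x\<bar> \<le> C"
  shows "integrable (lebesgue_on \<Omega>) f"
proof -
  interpret finite_measure "lebesgue_on \<Omega>"
    by (rule finite_measure_lebesgue_on_bounded_open) fact+
  show ?thesis by (rule integrable_const_bound[where B=C]) (use assms in auto)
qed

lemma square_integrable_imp_integrable:
  fixes f :: "'a::euclidean_space \<Rightarrow> real"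
  assumes "open \<Omega>" "bounded \<Omega>" "square_integrable_on \<Omega> f"
  shows "integrable (lebesgue_on \<Omega>) f"
proof (rule Bochner_Integration.integrable_bound)
  interpret finite_measure "lebesgue_on \<Omega>"
    by (rule finite_measure_lebesgue_on_bounded_open) fact+
  show "integrable (lebesgue_on \<Omega>) (\<lambda>x. 1 + (norm (f x))\<^sup>2)"
    using assms(3) by (auto simp: square_integrable_on_def)
  show "AE x in lebesgue_on \<Omega>. norm (f x) \<le> norm (1 + (norm (f x))\<^sup>2)"
  proof (rule AE_I2)
    fix x
    have "0 \<le> (\<bar>f x\<bar> - 1)\<^sup>2" by simp
    then have "2 * \<bar>f x\<bar> \<le> 1 + (f x)\<^sup>2" by (simp add: power2_diff)
    then show "norm (f x) \<le> norm (1 + (norm (f x))\<^sup>2)" by simp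
  qed
  show "f \<in> borel_measurable (lebesgue_on \<Omega>)" using assms(3) by (simp add: square_integrable_on_def)
qed

lemma square_integrable_on_inner:
  assumes "square_integrable_on \<Omega> (g :: 'a::euclidean_space \<Rightarrow> 'a)" "b \<in> Basis"
  shows "square_integrable_on \<Omega> (\<lambda>x. g x \<bullet> b)"
proof -
  have [measurable]: "g \<in> borel_measurable (lebesgue_on \<Omega>)"
    and i: "integrable (lebesgue_on \<Omega>) (\<lambda>x. (norm (g x))\<^sup>2)"
    using assms by (auto simp: square_integrable_on_def)
  have "integrable (lebesgue_on \<Omega>) (\<lambda>x. (norm (g x \<bullet> b))\<^sup>2)"
    using i
  proof (rule Bochner_Integration.integrable_bound)
    have "(norm (g x \<bullet> b))\<^sup>2 \<le> (norm (g x))\<^sup>2" for x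
      using Basis_le_norm[OF assms(2), of "g x"] by (intro power_mono) auto
    then show "AE x in lebesgue_on \<Omega>. norm ((norm (g x \<bullet> b))\<^sup>2) \<le> norm ((norm (g x))\<^sup>2)" by simp
  qed auto
  then show ?thesis by (simp add: square_integrable_on_def)
qed

text \<open>Each component of the gradient gets its own representative, since convolution and
  \<open>weak_partial\<close> deal with scalar functions and one direction at a time.\<close>

lemma H1_borel_versions:
  fixes \<Omega> :: "'a::euclidean_space set"
  assumes \<Omega>: "open \<Omega>" "bounded \<Omega>" and H: "H1_on \<Omega> u g"
  obtains U G where "U \<in> borel_measurable borel" "\<And>x. x \<notin> \<Omega> \<Longrightarrow> U x = 0"
    "AE x in lborel. x \<in> \<Omega> \<longrightarrow> u x = U x"
    "\<And>b. b \<in> Basis \<Longrightarrow> G b \<in> borel_measurable borel"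
    "\<And>b x. b \<in> Basis \<Longrightarrow> x \<notin> \<Omega> \<Longrightarrow> G b x = 0"
    "\<And>b. b \<in> Basis \<Longrightarrow> AE x in lborel. x \<in> \<Omega> \<longrightarrow> g x \<bullet> b = G b x"
    "\<And>b. b \<in> Basis \<Longrightarrow> weak_partial \<Omega> b U (G b)"
proof -
  have u: "square_integrable_on \<Omega> u" and g: "square_integrable_on \<Omega> g"
    and weak: "\<And>\<phi> b. test_function \<Omega> \<phi> \<Longrightarrow> b \<in> Basis \<Longrightarrow>
      (\<integral>x. u x * frechet_derivative \<phi> (at x) b \<partial>lebesgue_on \<Omega>) = - (\<integral>x. (g x \<bullet> b) * \<phi> x \<partial>lebesgue_on \<Omega>)"
    using H by (auto simp: H1_on_def)
  have gb: "integrable (lebesgue_on \<Omega>) (\<lambda>x. g x \<bullet> b)" if "b \<in> Basis" for b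
    using square_integrable_imp_integrable[OF \<Omega> square_integrable_on_inner[OF g that]] .
  have iu: "integrable (lebesgue_on \<Omega>) u" by (rule square_integrable_imp_integrable[OF \<Omega> u])
  obtain U where U: "U \<in> borel_measurable borel" "\<And>x. x \<notin> \<Omega> \<Longrightarrow> U x = 0"
    "AE x in lborel. x \<in> \<Omega> \<longrightarrow> u x = U x"
    using lebesgue_on_borel_version_exists[OF \<Omega>(1) borel_measurable_integrable[OF iu]] by metis
  have "\<forall>b\<in>Basis. \<exists>G. G \<in> borel_measurable borel \<and> (\<forall>x. x \<notin> \<Omega> \<longrightarrow> G x = 0) \<and>
      (AE x in lborel. x \<in> \<Omega> \<longrightarrow> g x \<bullet> b = G x)"
    using lebesgue_on_borel_version_exists[OF \<Omega>(1) borel_measurable_integrable[OF gb]] by metis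
  from bchoice[OF this] obtain G where
    "\<forall>b\<in>Basis. G b \<in> borel_measurable borel \<and> (\<forall>x. x \<notin> \<Omega> \<longrightarrow> G b x = 0) \<and>
      (AE x in lborel. x \<in> \<Omega> \<longrightarrow> g x \<bullet> b = G b x)" ..
  then have G: "\<And>b. b \<in> Basis \<Longrightarrow> G b \<in> borel_measurable borel"
    "\<And>b x. b \<in> Basis \<Longrightarrow> x \<notin> \<Omega> \<Longrightarrow> G b x = 0"
    "\<And>b. b \<in> Basis \<Longrightarrow> AE x in lborel. x \<in> \<Omega> \<longrightarrow> g x \<bullet> b = G b x"
    by auto
  have "weak_partial \<Omega> b U (G b)" if b: "b \<in> Basis" for b
    unfolding weak_partial_def
  proof (intro conjI allI impI)
    show "integrable lborel U"
      using integral_lebesgue_on_borel_version(2)[OF \<Omega>(1) borel_measurable_integrable[OF iu] U] iu by simp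
    show "integrable lborel (G b)"
      using integral_lebesgue_on_borel_version(2)[OF \<Omega>(1) borel_measurable_integrable[OF gb[OF b]] G[OF b]] gb[OF b] by simp
    fix \<phi> :: "'a \<Rightarrow> real" assume \<phi>: "test_function \<Omega> \<phi>"
    note f = smooth_compact_support_facts[OF test_function_facts(1,2)[OF \<phi>]]
    have [measurable]: "\<phi> \<in> borel_measurable borel" "(\<lambda>x. frechet_derivative \<phi> (at x) b) \<in> borel_measurable borel"
      by (rule f)+
    have [measurable]: "\<phi> \<in> borel_measurable (lebesgue_on \<Omega>)"
      "(\<lambda>x. frechet_derivative \<phi> (at x) b) \<in> borel_measurable (lebesgue_on \<Omega>)"
      by (intro measurable_restrict_space1 measurable_completion; simp)+
    have [measurable]: "u \<in> borel_measurable (lebesgue_on \<Omega>)" "(\<lambda>x. g x \<bullet> b) \<in> borel_measurable (lebesgue_on \<Omega>)"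
      using iu gb[OF b] by auto
    have [measurable]: "U \<in> borel_measurable borel" "G b \<in> borel_measurable borel"
      using U G b by auto
    have "(\<integral>x. u x * frechet_derivative \<phi> (at x) b \<partial>lebesgue_on \<Omega>)
        = (\<integral>x. U x * frechet_derivative \<phi> (at x) b \<partial>lborel)"
    proof (rule integral_lebesgue_on_borel_version(1)[OF \<Omega>(1)])
      show "AE x in lborel. x \<in> \<Omega> \<longrightarrow> u x * frechet_derivative \<phi> (at x) b = U x * frechet_derivative \<phi> (at x) b"
        using U(3) by eventually_elim simp
    qed (use U(2) in auto)
    moreover have "(\<integral>x. (g x \<bullet> b) * \<phi> x \<partial>lebesgue_on \<Omega>) = (\<integral>x. G b x * \<phi> x \<partial>lborel)"
    proof (rule integral_lebesgue_on_borel_version(1)[OF \<Omega>(1)])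
      show "AE x in lborel. x \<in> \<Omega> \<longrightarrow> (g x \<bullet> b) * \<phi> x = G b x * \<phi> x"
        using G(3)[OF b] by eventually_elim simp
    qed (use G(2)[OF b] in auto)
    ultimately show "(\<integral>x. U x * frechet_derivative \<phi> (at x) b \<partial>lborel) = - (\<integral>x. G b x * \<phi> x \<partial>lborel)"
      using weak[OF \<phi> b] by simp
  qed
  with U G that show ?thesis by blast
qed

text \<open>The bound on F makes the composition square integrable on the bounded set \<Omega>, and
  later also admissible in the weak equation; the bound on F' does the same for the
  gradient.\<close>

lemma H1_chain_rule:
  fixes \<Omega> :: "'a::euclidean_space set"
  assumes \<Omega>: "open \<Omega>" "bounded \<Omega>" and H: "H1_on \<Omega> u g"
    and F: "\<And>s. (F has_real_derivative F' s) (at s)" "continuous_on UNIV F'"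
      "\<And>s. \<bar>F s\<bar> \<le> B" "\<And>s. \<bar>F' s\<bar> \<le> L"
  shows "H1_on \<Omega> (\<lambda>x. F (u x)) (\<lambda>x. F' (u x) *\<^sub>R g x)"
proof -
  have u: "square_integrable_on \<Omega> u" and g: "square_integrable_on \<Omega> g"
    using H by (auto simp: H1_on_def)
  have contF: "continuous_on UNIV F"
    using DERIV_isCont[OF F(1)] by (simp add: continuous_on_eq_continuous_at)
  have [measurable]: "F \<in> borel_measurable borel" "F' \<in> borel_measurable borel"
    using contF F(2) by (auto intro: borel_measurable_continuous_onI)
  have [measurable]: "u \<in> borel_measurable (lebesgue_on \<Omega>)" "g \<in> borel_measurable (lebesgue_on \<Omega>)"
    using u g by (auto simp: square_integrable_on_def)
  have BL: "0 \<le> B" "0 \<le> L" using F(3)[of 0] F(4)[of 0] by linarith+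
  have "square_integrable_on \<Omega> (\<lambda>x. F (u x))"
  proof -
    have "\<bar>(norm (F (u x)))\<^sup>2\<bar> \<le> B\<^sup>2" for x using power_mono[OF F(3)[of "u x"], of 2] by simp
    then have "integrable (lebesgue_on \<Omega>) (\<lambda>x. (norm (F (u x)))\<^sup>2)"
      by (intro bounded_imp_integrable_lebesgue_on[OF \<Omega>]) auto
    then show ?thesis by (simp add: square_integrable_on_def)
  qed
  moreover have "square_integrable_on \<Omega> (\<lambda>x. F' (u x) *\<^sub>R g x)"
  proof -
    have "integrable (lebesgue_on \<Omega>) (\<lambda>x. L\<^sup>2 * (norm (g x))\<^sup>2)"
      using g by (auto simp: square_integrable_on_def)
    then have "integrable (lebesgue_on \<Omega>) (\<lambda>x. (norm (F' (u x) *\<^sub>R g x))\<^sup>2)"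
    proof (rule Bochner_Integration.integrable_bound)
      have "(norm (F' (u x) *\<^sub>R g x))\<^sup>2 \<le> L\<^sup>2 * (norm (g x))\<^sup>2" for x
        using F(4)[of "u x"] BL by (simp add: power_mult_distrib abs_le_square_iff[symmetric] mult_right_mono)
      then show "AE x in lebesgue_on \<Omega>. norm ((norm (F' (u x) *\<^sub>R g x))\<^sup>2) \<le> norm (L\<^sup>2 * (norm (g x))\<^sup>2)"
        by simp
    qed auto
    then show ?thesis by (simp add: square_integrable_on_def)
  qed
  moreover have "(\<integral>x. F (u x) * frechet_derivative \<phi> (at x) b \<partial>lebesgue_on \<Omega>)
      = - (\<integral>x. ((F' (u x) *\<^sub>R g x) \<bullet> b) * \<phi> x \<partial>lebesgue_on \<Omega>)"
    if \<phi>: "test_function \<Omega> \<phi>" and b: "b \<in> Basis" for \<phi> b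
  proof -
    obtain U G where U: "U \<in> borel_measurable borel" "\<And>x. x \<notin> \<Omega> \<Longrightarrow> U x = 0"
      "AE x in lborel. x \<in> \<Omega> \<longrightarrow> u x = U x"
      and G: "\<And>b. b \<in> Basis \<Longrightarrow> G b \<in> borel_measurable borel"
      "\<And>b x. b \<in> Basis \<Longrightarrow> x \<notin> \<Omega> \<Longrightarrow> G b x = 0"
      "\<And>b. b \<in> Basis \<Longrightarrow> AE x in lborel. x \<in> \<Omega> \<longrightarrow> g x \<bullet> b = G b x"
      and w: "\<And>b. b \<in> Basis \<Longrightarrow> weak_partial \<Omega> b U (G b)"
      by (rule H1_borel_versions[OF \<Omega> H]) blast
    note t = test_function_facts[OF \<phi>]
    note f = smooth_compact_support_facts[OF t(1,2)]
    have [measurable]: "\<phi> \<in> borel_measurable borel" "(\<lambda>x. frechet_derivative \<phi> (at x) b) \<in> borel_measurable borel"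
      by (rule f)+
    have [measurable]: "\<phi> \<in> borel_measurable (lebesgue_on \<Omega>)"
      "(\<lambda>x. frechet_derivative \<phi> (at x) b) \<in> borel_measurable (lebesgue_on \<Omega>)"
      by (intro measurable_restrict_space1 measurable_completion; simp)+
    have [measurable]: "U \<in> borel_measurable borel" "G b \<in> borel_measurable borel"
      using U G b by auto
    have "(\<integral>x. F (u x) * frechet_derivative \<phi> (at x) b \<partial>lebesgue_on \<Omega>)
        = (\<integral>x. F (U x) * frechet_derivative \<phi> (at x) b \<partial>lborel)"
    proof (rule integral_lebesgue_on_borel_version(1)[OF \<Omega>(1)])
      show "AE x in lborel. x \<in> \<Omega> \<longrightarrow> F (u x) * frechet_derivative \<phi> (at x) b = F (U x) * frechet_derivative \<phi> (at x) b"
        using U(3) by eventually_elim simp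
    qed (use t(5) in auto)
    also have "\<dots> = - (\<integral>x. F' (U x) * G b x * \<phi> x \<partial>lborel)"
      by (rule weak_partial_chain_rule[OF \<Omega>(1) w[OF b] F \<phi>])
    also have "(\<integral>x. F' (U x) * G b x * \<phi> x \<partial>lborel)
        = (\<integral>x. ((F' (u x) *\<^sub>R g x) \<bullet> b) * \<phi> x \<partial>lebesgue_on \<Omega>)"
    proof (rule integral_lebesgue_on_borel_version(1)[OF \<Omega>(1), symmetric])
      show "AE x in lborel. x \<in> \<Omega> \<longrightarrow> ((F' (u x) *\<^sub>R g x) \<bullet> b) * \<phi> x = F' (U x) * G b x * \<phi> x"
        using U(3) G(3)[OF b] by eventually_elim simp
    qed (use t(4) in auto)
    finally show ?thesis .
  qed
  ultimately show ?thesis by (simp add: H1_on_def)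
qed

lemma H1_gradient_zero_imp_const:
  fixes \<Omega> :: "'a::euclidean_space set"
  assumes \<Omega>: "open \<Omega>" "bounded \<Omega>" "connected \<Omega>" and H: "H1_on \<Omega> u g"
    and g: "AE x in lebesgue_on \<Omega>. g x = 0"
  obtains c where "AE x in lebesgue_on \<Omega>. u x = c"
proof -
  obtain U G where U: "U \<in> borel_measurable borel" "\<And>x. x \<notin> \<Omega> \<Longrightarrow> U x = 0"
    "AE x in lborel. x \<in> \<Omega> \<longrightarrow> u x = U x"
    and G: "\<And>b. b \<in> Basis \<Longrightarrow> G b \<in> borel_measurable borel"
    "\<And>b x. b \<in> Basis \<Longrightarrow> x \<notin> \<Omega> \<Longrightarrow> G b x = 0"
    "\<And>b. b \<in> Basis \<Longrightarrow> AE x in lborel. x \<in> \<Omega> \<longrightarrow> g x \<bullet> b = G b x"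
    and w: "\<And>b. b \<in> Basis \<Longrightarrow> weak_partial \<Omega> b U (G b)"
    by (rule H1_borel_versions[OF \<Omega>(1,2) H]) blast
  have g': "AE x in lborel. x \<in> \<Omega> \<longrightarrow> g x = 0"
    using g AE_lebesgue_on_iff[OF \<Omega>(1), of "\<lambda>x. g x = 0"] by simp
  have "weak_partial \<Omega> b U (\<lambda>_. 0)" if b: "b \<in> Basis" for b
  proof -
    have "AE x in lborel. G b x = 0"
      using g' G(3)[OF b] by eventually_elim (use G(2)[OF b] in force)
    then have "(\<integral>x. G b x * \<phi> x \<partial>lborel) = 0" for \<phi>
      by (intro integral_eq_zero_AE) auto
    then show ?thesis using w[OF b] by (simp add: weak_partial_def)
  qed
  then obtain c where "AE x in lborel. x \<in> \<Omega> \<longrightarrow> U x = c"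
    using weak_partial_zero_imp_const[OF \<Omega>(1,3)] by blast
  with U(3) have "AE x in lborel. x \<in> \<Omega> \<longrightarrow> u x = c" by eventually_elim auto
  then have "AE x in lebesgue_on \<Omega>. u x = c"
    using AE_lebesgue_on_iff[OF \<Omega>(1), of "\<lambda>x. u x = c"] by simp
  then show ?thesis by (rule that)
qed

text \<open>Supplies two kinds of test functions for the weak equation: constants and functions of
  compact support. Since v times \<phi> has compact support whatever v is, integration by parts has
  no boundary term.\<close>

lemma H1_smooth:
  fixes \<Omega> :: "'a::euclidean_space set"
  assumes \<Omega>: "open \<Omega>" "bounded \<Omega>" and v: "smooth_on UNIV v" "\<And>x. \<bar>v x\<bar> \<le> P"
    and v': "\<And>x h. \<bar>frechet_derivative v (at x) h\<bar> \<le> L * norm h"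
  shows "H1_on \<Omega> v (\<lambda>x. \<Sum>b\<in>Basis. frechet_derivative v (at x) b *\<^sub>R b)"
proof -
  let ?v' = "\<lambda>x. frechet_derivative v (at x)"
  let ?g = "\<lambda>x. \<Sum>b\<in>Basis. ?v' x b *\<^sub>R b"
  have vb[measurable]: "v \<in> borel_measurable borel" "(\<lambda>x. ?v' x b) \<in> borel_measurable borel" for b
    using smooth_on_UNIV_continuous[OF v(1)] smooth_on_UNIV_derivative_continuous[OF v(1)]
    by (auto intro: borel_measurable_continuous_onI)
  have [measurable]: "v \<in> borel_measurable (lebesgue_on \<Omega>)"
    "(\<lambda>x. ?v' x b) \<in> borel_measurable (lebesgue_on \<Omega>)" for b
    by (intro measurable_restrict_space1 measurable_completion; simp)+
  have PL: "0 \<le> P" using v(2)[of 0] by linarith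
  have "square_integrable_on \<Omega> v"
  proof -
    have "\<bar>(norm (v x))\<^sup>2\<bar> \<le> P\<^sup>2" for x using power_mono[OF v(2)[of x], of 2] by simp
    then have "integrable (lebesgue_on \<Omega>) (\<lambda>x. (norm (v x))\<^sup>2)"
      by (intro bounded_imp_integrable_lebesgue_on[OF \<Omega>]) auto
    then show ?thesis by (simp add: square_integrable_on_def)
  qed
  moreover have "square_integrable_on \<Omega> ?g"
  proof -
    have "norm (?g x) \<le> (\<Sum>b\<in>(Basis::'a set). L)" for x
    proof (rule sum_norm_le)
      show "norm (?v' x b *\<^sub>R b) \<le> L" if "b \<in> Basis" for b
        using v'[of x b] that by simp
    qed
    then have "\<bar>(norm (?g x))\<^sup>2\<bar> \<le> (\<Sum>b\<in>(Basis::'a set). L)\<^sup>2" for x by (auto intro: power_mono)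
    then have "integrable (lebesgue_on \<Omega>) (\<lambda>x. (norm (?g x))\<^sup>2)"
      by (intro bounded_imp_integrable_lebesgue_on[OF \<Omega>]) auto
    then show ?thesis by (simp add: square_integrable_on_def)
  qed
  moreover have "(\<integral>x. v x * frechet_derivative \<phi> (at x) b \<partial>lebesgue_on \<Omega>)
      = - (\<integral>x. (?g x \<bullet> b) * \<phi> x \<partial>lebesgue_on \<Omega>)"
    if \<phi>: "test_function \<Omega> \<phi>" and b: "b \<in> Basis" for \<phi> b
  proof -
    let ?\<phi>' = "\<lambda>x. frechet_derivative \<phi> (at x)"
    note t = test_function_facts[OF \<phi>]
    note f = smooth_compact_support_facts[OF t(1,2)]
    have [measurable]: "\<phi> \<in> borel_measurable borel" "(\<lambda>x. ?\<phi>' x b) \<in> borel_measurable borel"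
      by (rule f)+
    have [measurable]: "\<phi> \<in> borel_measurable (lebesgue_on \<Omega>)"
      "(\<lambda>x. ?\<phi>' x b) \<in> borel_measurable (lebesgue_on \<Omega>)"
      by (intro measurable_restrict_space1 measurable_completion; simp)+
    obtain Q where Q: "\<And>x. \<bar>\<phi> x\<bar> \<le> Q" using f(5) by blast
    obtain L1 where L1: "\<And>x h. \<bar>?\<phi>' x h\<bar> \<le> L1 * norm h"
      using smooth_compact_support_derivative_bound[OF t(1,2)] by metis
    have Q0: "0 \<le> Q" using Q[of 0] by linarith
    have gb: "?g x \<bullet> b = ?v' x b" for x using b by (simp add: inner_sum_left inner_Basis if_distrib cong: if_cong)
    have nb: "norm b = 1" using b by simp
    have L0: "0 \<le> L" using v'[of 0 b] nb by simp
    have "(\<integral>x. ?v' x b * \<phi> x + v x * ?\<phi>' x b \<partial>lborel) = 0"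
    proof (rule integral_directional_derivative_zero)
      show "(\<lambda>x. v x * \<phi> x) \<in> borel_measurable borel" by measurable
      show "bounded {x. v x * \<phi> x \<noteq> 0}" by (rule bounded_subset[OF t(6)]) auto
      show "\<bar>v x * \<phi> x\<bar> \<le> P * Q" for x
        unfolding abs_mult by (intro mult_mono v Q PL) auto
      show "\<bar>?v' x b * \<phi> x + v x * ?\<phi>' x b\<bar> \<le> L * norm b * Q + P * (L1 * norm b)" for x
      proof -
        have "\<bar>?v' x b * \<phi> x\<bar> \<le> L * norm b * Q"
          unfolding abs_mult using L0 by (intro mult_mono v' Q) auto
        moreover have "\<bar>v x * ?\<phi>' x b\<bar> \<le> P * (L1 * norm b)"
          unfolding abs_mult by (intro mult_mono v L1 PL) auto
        ultimately show ?thesis by linarith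
      qed
      show "((\<lambda>t. v (x + t *\<^sub>R b) * \<phi> (x + t *\<^sub>R b)) has_real_derivative
          ?v' x b * \<phi> x + v x * ?\<phi>' x b) (at 0)" for x
        using DERIV_mult[OF has_derivative_along_line[OF smooth_on_UNIV_has_derivative[OF v(1)]]
            has_derivative_along_line[OF smooth_on_UNIV_has_derivative[OF t(1)]], of x b x b]
        by (simp add: algebra_simps)
    qed
    moreover have "integrable lborel (\<lambda>x. \<phi> x * ?v' x b)"
      using f(3) by (rule integrable_mult_bounded[where C="L * norm b"]) (use v' in auto)
    moreover have "integrable lborel (\<lambda>x. ?\<phi>' x b * v x)"
      using f(4) by (rule integrable_mult_bounded[where C=P]) (use v in auto)
    ultimately have "(\<integral>x. v x * ?\<phi>' x b \<partial>lborel) = - (\<integral>x. ?v' x b * \<phi> x \<partial>lborel)"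
      by (simp add: mult.commute)
    moreover have "(\<integral>x. v x * ?\<phi>' x b \<partial>lebesgue_on \<Omega>) = (\<integral>x. v x * ?\<phi>' x b \<partial>lborel)"
      by (rule integral_lebesgue_on_borel_version(1)[OF \<Omega>(1)]) (use t(5) in auto)
    moreover have "(\<integral>x. ?v' x b * \<phi> x \<partial>lebesgue_on \<Omega>) = (\<integral>x. ?v' x b * \<phi> x \<partial>lborel)"
      by (rule integral_lebesgue_on_borel_version(1)[OF \<Omega>(1)]) (use t(4) in auto)
    ultimately show ?thesis by (simp add: gb)
  qed
  ultimately show ?thesis by (simp add: H1_on_def)
qed

lemma H1_const:
  fixes \<Omega> :: "'a::euclidean_space set"
  assumes "open \<Omega>" "bounded \<Omega>"
  shows "H1_on \<Omega> (\<lambda>_. c) (\<lambda>_. 0)"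
proof -
  have "H1_on \<Omega> (\<lambda>_. c) (\<lambda>x. \<Sum>b\<in>Basis. frechet_derivative (\<lambda>_. c) (at x) b *\<^sub>R b)"
    by (rule H1_smooth[OF assms smooth_alg_smooth_on[OF smooth_alg.const], of _ "\<bar>c\<bar>" 0])
      (auto simp: frechet_derivative_const)
  then show ?thesis by (simp add: frechet_derivative_const)
qed

lemma H1_test_function:
  fixes \<Omega> :: "'a::euclidean_space set"
  assumes "open \<Omega>" "bounded \<Omega>" and \<phi>: "test_function \<Omega> \<phi>"
  shows "\<exists>h. H1_on \<Omega> \<phi> h"
proof -
  note t = test_function_facts[OF \<phi>]
  obtain P where "\<And>x. \<bar>\<phi> x\<bar> \<le> P" using smooth_compact_support_facts(5)[OF t(1,2)] by blast
  moreover obtain L where "\<And>x h. \<bar>frechet_derivative \<phi> (at x) h\<bar> \<le> L * norm h"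
    using smooth_compact_support_derivative_bound[OF t(1,2)] by metis
  ultimately show ?thesis using H1_smooth[OF assms(1,2) t(1)] by blast
qed

section \<open>Estimates for weak Neumann solutions\<close>

lemma min_zero_square_has_derivative:
  "((\<lambda>s::real. (min s 0)\<^sup>2) has_real_derivative 2 * min s 0) (at s)"
proof -
  consider "s < 0" | "s = 0" | "s > 0" by linarith
  then show ?thesis
  proof cases
    case 1
    have "((\<lambda>s. s\<^sup>2) has_real_derivative 2 * s) (at s)" by (auto intro!: derivative_eq_intros)
    then have "((\<lambda>s::real. (min s 0)\<^sup>2) has_real_derivative 2 * s) (at s)"
      by (rule has_field_derivative_transform_within_open[of _ _ _ "{..<0}"]) (use 1 in auto)
    then show ?thesis using 1 by simp
  next
    case 2
    have "((\<lambda>h::real. (min h 0)\<^sup>2 / h) \<longlongrightarrow> 0) (at 0)"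
    proof (rule Lim_null_comparison)
      show "\<forall>\<^sub>F h::real in at 0. norm ((min h 0)\<^sup>2 / h) \<le> \<bar>h\<bar>"
        by (intro always_eventually) (auto simp: min_def power2_eq_square)
      show "((\<lambda>h::real. \<bar>h\<bar>) \<longlongrightarrow> 0) (at 0)"
        by (auto intro!: tendsto_eq_intros)
    qed
    then show ?thesis using 2 by (simp add: DERIV_def)
  next
    case 3
    have "((\<lambda>s. 0) has_real_derivative 0) (at s)" by simp
    then have "((\<lambda>s::real. (min s 0)\<^sup>2) has_real_derivative 0) (at s)"
      by (rule has_field_derivative_transform_within_open[of _ _ _ "{0<..}"]) (use 3 in auto)
    then show ?thesis using 3 by simp
  qed
qed

text \<open>A bounded C1 substitute for the truncation \<open>min s 0\<close>: the square smooths
  the kink at 0 and the denominator makes it bounded.\<close>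

definition neg_cutoff :: "real \<Rightarrow> real" where
  "neg_cutoff s = - (min s 0)\<^sup>2 / (1 + s\<^sup>2)"

definition neg_cutoff' :: "real \<Rightarrow> real" where
  "neg_cutoff' s = - 2 * min s 0 / (1 + s\<^sup>2)\<^sup>2"

text \<open>The first four facts are the hypotheses of \<open>H1_chain_rule\<close>; the other four
  give the signs of the gradient, source and absorption terms when the equation is tested with
  \<open>neg_cutoff (u x)\<close>.\<close>

lemma neg_cutoff:
  shows "(neg_cutoff has_real_derivative neg_cutoff' s) (at s)"
    and "continuous_on UNIV neg_cutoff'" and "\<bar>neg_cutoff s\<bar> \<le> 1" and "\<bar>neg_cutoff' s\<bar> \<le> 1"
    and "0 \<le> neg_cutoff' s" and "neg_cutoff s \<le> 0" and "neg_cutoff s = 0 \<longleftrightarrow> 0 \<le> s"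
    and "0 \<le> s * neg_cutoff s"
proof -
  have pos: "1 + s\<^sup>2 > 0" for s :: real by (simp add: add_pos_nonneg)
  \<comment> \<open>The cubic terms cancel because
    \<open>(min s 0)\<^sup>2 * s = min s 0 * s\<^sup>2\<close>.\<close>
  have eq: "(- (2 * min s 0) * (1 + s\<^sup>2) - - (min s 0)\<^sup>2 * (2 * s)) = - 2 * min s 0"
    by (auto simp: min_def power2_eq_square algebra_simps)
  have "(neg_cutoff has_real_derivative
      (- (2 * min s 0) * (1 + s\<^sup>2) - - (min s 0)\<^sup>2 * (2 * s)) / ((1 + s\<^sup>2) * (1 + s\<^sup>2))) (at s)"
    unfolding neg_cutoff_def[abs_def]
    by (rule DERIV_divide[OF DERIV_minus[OF min_zero_square_has_derivative]])
      (use pos[of s] in \<open>auto intro!: derivative_eq_intros\<close>)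
  then show "(neg_cutoff has_real_derivative neg_cutoff' s) (at s)"
    unfolding eq by (simp add: neg_cutoff'_def power2_eq_square)
  show "continuous_on UNIV neg_cutoff'"
    unfolding neg_cutoff'_def[abs_def] using pos
    by (intro continuous_intros) (auto simp: less_imp_neq[THEN not_sym])
  have m: "(min s 0)\<^sup>2 \<le> s\<^sup>2" by (simp add: min_def)
  show "\<bar>neg_cutoff s\<bar> \<le> 1"
    using m pos[of s] by (simp add: neg_cutoff_def abs_divide divide_le_eq)
  have "2 * \<bar>s\<bar> \<le> 1 + s\<^sup>2"
    using zero_le_power2[of "\<bar>s\<bar> - 1"] by (simp add: power2_diff)
  also have "1 + s\<^sup>2 \<le> (1 + s\<^sup>2)\<^sup>2"
    using pos[of s] by (simp add: power2_eq_square mult_le_cancel_left1)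
  finally have "- 2 * min s 0 \<le> (1 + s\<^sup>2)\<^sup>2" by (auto simp: min_def)
  then have "neg_cutoff' s \<le> 1"
    unfolding neg_cutoff'_def using pos[of s] by (subst divide_le_eq_1_pos) auto
  moreover show "0 \<le> neg_cutoff' s"
    unfolding neg_cutoff'_def by (rule divide_nonneg_nonneg) (auto simp: min_def)
  ultimately show "\<bar>neg_cutoff' s\<bar> \<le> 1" by simp
  show "neg_cutoff s \<le> 0"
    using pos[of s] by (simp add: neg_cutoff_def)
  show "neg_cutoff s = 0 \<longleftrightarrow> 0 \<le> s"
    using pos[of s] by (auto simp: neg_cutoff_def)
  then show "0 \<le> s * neg_cutoff s"
    using \<open>neg_cutoff s \<le> 0\<close> by (cases "0 \<le> s") (auto simp: mult_nonpos_nonpos)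
qed

text \<open>The regularised reciprocal is C1 on the whole line with bounds depending on d. The last
  fact replaces \<open>s * (1 / s) = 1\<close> and bounds the absorption term by \<rho>.\<close>

lemma inverse_sqrt:
  fixes d s :: real
  assumes d: "0 < d"
  shows "((\<lambda>s. 1 / sqrt (d + s\<^sup>2)) has_real_derivative - s / sqrt (d + s\<^sup>2) ^ 3) (at s)"
    and "continuous_on UNIV (\<lambda>s. - s / sqrt (d + s\<^sup>2) ^ 3)"
    and "\<bar>1 / sqrt (d + s\<^sup>2)\<bar> \<le> 1 / sqrt d"
    and "\<bar>- s / sqrt (d + s\<^sup>2) ^ 3\<bar> \<le> 1 / d"
    and "s / sqrt (d + s\<^sup>2) \<le> 1"
proof -
  have pos: "d + s\<^sup>2 > 0" for s :: real using d by (simp add: add_pos_nonneg)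
  have sp: "sqrt (d + s\<^sup>2) > 0" for s using pos by simp
  show "((\<lambda>s. 1 / sqrt (d + s\<^sup>2)) has_real_derivative - s / sqrt (d + s\<^sup>2) ^ 3) (at s)"
    using pos[of s] sp[of s]
    by (auto intro!: derivative_eq_intros simp: power2_eq_square power3_eq_cube field_simps)
  show "continuous_on UNIV (\<lambda>s. - s / sqrt (d + s\<^sup>2) ^ 3)"
    using sp by (intro continuous_intros) (auto simp: less_imp_neq[THEN not_sym])
  show "\<bar>1 / sqrt (d + s\<^sup>2)\<bar> \<le> 1 / sqrt d"
    using sp[of s] d by (simp add: frac_le)
  have s: "\<bar>s\<bar> \<le> sqrt (d + s\<^sup>2)"
    using d by (intro real_le_rsqrt) simp
  show "s / sqrt (d + s\<^sup>2) \<le> 1"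
    using s sp[of s] by (simp add: divide_le_eq)
  have "\<bar>- s / sqrt (d + s\<^sup>2) ^ 3\<bar> = (\<bar>s\<bar> / sqrt (d + s\<^sup>2)) / (sqrt (d + s\<^sup>2))\<^sup>2"
    using sp[of s] by (simp add: power2_eq_square power3_eq_cube)
  also have "\<dots> \<le> 1 / d"
    using s sp[of s] d pos[of s] by (intro frac_le) (auto simp: divide_le_eq)
  finally show "\<bar>- s / sqrt (d + s\<^sup>2) ^ 3\<bar> \<le> 1 / d" .
qed

lemma mean_passage_time_eq_infinity:
  assumes m: "(\<lambda>x. \<omega> x * u x) \<in> borel_measurable (lebesgue_on \<Omega>)"
    and nn: "AE x in lebesgue_on \<Omega>. 0 \<le> \<omega> x * u x"
    and ni: "\<not> integrable (lebesgue_on \<Omega>) (\<lambda>x. \<omega> x * u x)"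
  shows "mean_passage_time \<Omega> \<omega> u = \<infinity>"
proof -
  have "(\<integral>\<^sup>+x. ennreal (\<omega> x * u x) \<partial>lebesgue_on \<Omega>) = \<infinity>"
    using integrableI_nonneg[OF m nn] ni by (metis infinity_ennreal_def top.not_eq_extremum)
  moreover have "(\<integral>\<^sup>+x. ennreal (- (\<omega> x * u x)) \<partial>lebesgue_on \<Omega>) = (\<integral>\<^sup>+x. 0 \<partial>lebesgue_on \<Omega>)"
    by (rule nn_integral_cong_AE) (use nn in eventually_elim, auto simp: ennreal_neg)
  ultimately show ?thesis by (simp add: mean_passage_time_def)
qed

text \<open>The integral of (sqrt f - sqrt h)^2 is 1 + 1 - 2 = 0; this is the equality case of
  Cauchy-Schwarz for two functions of unit mass.\<close>

lemma density_eq_of_sqrt_integral: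
  assumes f: "density_on \<Omega> f" and h: "density_on \<Omega> h"
    and i: "integrable (lebesgue_on \<Omega>) (\<lambda>x. sqrt (f x * h x))"
    and one: "(\<integral>x. sqrt (f x * h x) \<partial>lebesgue_on \<Omega>) = 1"
  shows "AE x in lebesgue_on \<Omega>. f x = h x"
proof -
  let ?d = "\<lambda>x. f x + h x - 2 * sqrt (f x * h x)"
  have fh: "0 \<le> f x" "0 \<le> h x" if "x \<in> \<Omega>" for x
    using f h that by (auto simp: density_on_def)
  have sq: "?d x = (sqrt (f x) - sqrt (h x))\<^sup>2" if "x \<in> \<Omega>" for x
    using fh[OF that] by (simp add: power2_diff real_sqrt_mult)
  have id: "integrable (lebesgue_on \<Omega>) ?d" using f h i by (auto simp: density_on_def)
  have nn: "AE x in lebesgue_on \<Omega>. 0 \<le> ?d x" by (rule AE_I2) (simp add: sq)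
  have "(\<integral>x. ?d x \<partial>lebesgue_on \<Omega>) = 0"
    using f h i one by (simp add: density_on_def)
  then have "AE x in lebesgue_on \<Omega>. ?d x = 0"
    using integral_nonneg_eq_0_iff_AE[OF id nn] by simp
  then show ?thesis
    using AE_space
  proof eventually_elim
    case (elim x)
    then show ?case using sq[of x] fh[of x] by simp
  qed
qed

text \<open>The weak gradient g is a parameter, so that one fixed choice is shared by
  \<open>dissipation\<close> and all estimates.\<close>

locale neumann_solution =
  fixes \<Omega> :: "'a::euclidean_space set" and \<kappa> :: real and \<rho> M u :: "'a \<Rightarrow> real" and g :: "'a \<Rightarrow> 'a"
  assumes open_\<Omega>: "open \<Omega>" and bounded_\<Omega>: "bounded \<Omega>"
    and M_pos: "\<And>x. x \<in> \<Omega> \<Longrightarrow> 0 < M x" and M_integrable: "integrable (lebesgue_on \<Omega>) M"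
    and \<kappa>_pos: "0 < \<kappa>" and \<rho>: "density_on \<Omega> \<rho>"
    and H1: "H1_on \<Omega> u g" and \<rho>u: "integrable (lebesgue_on \<Omega>) (\<lambda>x. \<rho> x * u x)"
    and weak: "\<And>v h C. H1_on \<Omega> v h \<Longrightarrow> (AE x in lebesgue_on \<Omega>. \<bar>v x\<bar> \<le> C) \<Longrightarrow>
        (\<integral>x. g x \<bullet> h x \<partial>lebesgue_on \<Omega>) + \<kappa> * (\<integral>x. \<rho> x * u x * v x \<partial>lebesgue_on \<Omega>) =
        (\<integral>x. M x * v x \<partial>lebesgue_on \<Omega>)"
begin

lemma measurability [measurable]:
  "u \<in> borel_measurable (lebesgue_on \<Omega>)" "g \<in> borel_measurable (lebesgue_on \<Omega>)"
  "M \<in> borel_measurable (lebesgue_on \<Omega>)" "\<rho> \<in> borel_measurable (lebesgue_on \<Omega>)"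
  using H1 M_integrable \<rho> by (auto simp: H1_on_def square_integrable_on_def density_on_def)

lemma g_square_integrable: "integrable (lebesgue_on \<Omega>) (\<lambda>x. (norm (g x))\<^sup>2)"
  using H1 by (auto simp: H1_on_def square_integrable_on_def)

lemma weak_chain:
  assumes F: "\<And>s. (F has_real_derivative F' s) (at s)" "continuous_on UNIV F'"
      "\<And>s. \<bar>F s\<bar> \<le> B" "\<And>s. \<bar>F' s\<bar> \<le> L"
  shows "(\<integral>x. F' (u x) * (norm (g x))\<^sup>2 \<partial>lebesgue_on \<Omega>) + \<kappa> * (\<integral>x. \<rho> x * u x * F (u x) \<partial>lebesgue_on \<Omega>)
    = (\<integral>x. M x * F (u x) \<partial>lebesgue_on \<Omega>)"
  using weak[OF H1_chain_rule[OF open_\<Omega> bounded_\<Omega> H1 F], of B] F(3)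
  by (simp add: power2_norm_eq_inner)

text \<open>Tested with \<open>neg_cutoff (u x)\<close>, the gradient and absorption terms are
  nonnegative while the source term is nonpositive. Hence the source term vanishes, and M > 0 forces
  the cutoff to vanish almost everywhere.\<close>

lemma u_nonneg: "AE x in lebesgue_on \<Omega>. 0 \<le> u x"
proof -
  have cont: "continuous_on UNIV neg_cutoff"
    using DERIV_isCont[OF neg_cutoff(1)] by (simp add: continuous_on_eq_continuous_at)
  have [measurable]: "neg_cutoff \<in> borel_measurable borel"
    by (rule borel_measurable_continuous_onI[OF cont])
  have a: "0 \<le> (\<integral>x. neg_cutoff' (u x) * (norm (g x))\<^sup>2 \<partial>lebesgue_on \<Omega>)"
    using neg_cutoff(5) by (intro integral_nonneg_AE) auto
  have b: "0 \<le> (\<integral>x. \<rho> x * u x * neg_cutoff (u x) \<partial>lebesgue_on \<Omega>)"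
    using neg_cutoff(8) \<rho> by (intro integral_nonneg_AE AE_I2) (auto simp: density_on_def mult.assoc)
  have c: "(\<integral>x. neg_cutoff' (u x) * (norm (g x))\<^sup>2 \<partial>lebesgue_on \<Omega>)
      + \<kappa> * (\<integral>x. \<rho> x * u x * neg_cutoff (u x) \<partial>lebesgue_on \<Omega>) = (\<integral>x. M x * neg_cutoff (u x) \<partial>lebesgue_on \<Omega>)"
    by (rule weak_chain[OF neg_cutoff(1-4)])
  have ge: "0 \<le> (\<integral>x. M x * neg_cutoff (u x) \<partial>lebesgue_on \<Omega>)"
    unfolding c[symmetric] using \<kappa>_pos by (intro add_nonneg_nonneg mult_nonneg_nonneg a b) simp
  have i: "integrable (lebesgue_on \<Omega>) (\<lambda>x. - (M x * neg_cutoff (u x)))"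
    by (rule integrable_minus, rule integrable_mult_bounded[OF M_integrable _ neg_cutoff(3)]) measurable
  have nn: "AE x in lebesgue_on \<Omega>. 0 \<le> - (M x * neg_cutoff (u x))"
    using M_pos neg_cutoff(6) by (intro AE_I2) (auto simp: mult_nonneg_nonpos less_imp_le)
  have "(\<integral>x. - (M x * neg_cutoff (u x)) \<partial>lebesgue_on \<Omega>) = 0"
    using ge integral_nonneg_AE[OF nn] by simp
  then have "AE x in lebesgue_on \<Omega>. - (M x * neg_cutoff (u x)) = 0"
    using integral_nonneg_eq_0_iff_AE[OF i nn] by simp
  moreover have "AE x in lebesgue_on \<Omega>. x \<in> \<Omega>" by (rule AE_I2) simp
  ultimately show ?thesis
  proof eventually_elim
    case (elim x)
    then show ?case using M_pos[of x] neg_cutoff(7)[of "u x"] by auto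
  qed
qed

text \<open>The gradient term lost in testing with \<open>1 / sqrt (d + u\<^sup>2)\<close> increases as \<open>d\<close> decreases; its value at
  \<open>d = 1\<close> thus bounds it for all \<open>d \<le> 1\<close>, and it vanishes only if \<open>g = 0\<close>.\<close>

definition dissipation :: real where
  "dissipation = (\<integral>x. u x / sqrt (1 + (u x)\<^sup>2) ^ 3 * (norm (g x))\<^sup>2 \<partial>lebesgue_on \<Omega>)"

lemma weighted_gradient_integrable:
  assumes "0 < d"
  shows "integrable (lebesgue_on \<Omega>) (\<lambda>x. u x / sqrt (d + (u x)\<^sup>2) ^ 3 * (norm (g x))\<^sup>2)"
proof -
  have "integrable (lebesgue_on \<Omega>) (\<lambda>x. (norm (g x))\<^sup>2 * (u x / sqrt (d + (u x)\<^sup>2) ^ 3))"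
    using g_square_integrable inverse_sqrt(4)[OF assms]
    by (intro integrable_mult_bounded[where C="1 / d"]) auto
  then show ?thesis by (simp add: mult.commute)
qed

text \<open>The absorption term is at most \<kappa>, because
  \<open>u x / sqrt (d + (u x)\<^sup>2) \<le> 1\<close> and \<rho> has mass 1. The resulting bound
  no longer depends on d, which is what monotone convergence asks for.\<close>

lemma regularized_bound:
  assumes d: "0 < d" "d \<le> 1"
  shows "(\<integral>x. M x / sqrt (d + (u x)\<^sup>2) \<partial>lebesgue_on \<Omega>) \<le> \<kappa> - dissipation"
proof -
  have "(\<integral>x. - u x / sqrt (d + (u x)\<^sup>2) ^ 3 * (norm (g x))\<^sup>2 \<partial>lebesgue_on \<Omega>)
      + \<kappa> * (\<integral>x. \<rho> x * u x * (1 / sqrt (d + (u x)\<^sup>2)) \<partial>lebesgue_on \<Omega>)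
      = (\<integral>x. M x * (1 / sqrt (d + (u x)\<^sup>2)) \<partial>lebesgue_on \<Omega>)"
    by (rule weak_chain[OF inverse_sqrt(1-4)[OF d(1)]])
  moreover have "dissipation \<le> (\<integral>x. u x / sqrt (d + (u x)\<^sup>2) ^ 3 * (norm (g x))\<^sup>2 \<partial>lebesgue_on \<Omega>)"
    unfolding dissipation_def
  proof (rule integral_mono_AE)
    show "AE x in lebesgue_on \<Omega>. u x / sqrt (1 + (u x)\<^sup>2) ^ 3 * (norm (g x))\<^sup>2
        \<le> u x / sqrt (d + (u x)\<^sup>2) ^ 3 * (norm (g x))\<^sup>2"
      using u_nonneg
    proof eventually_elim
      case (elim x)
      have "0 < d + (u x)\<^sup>2" using d by (simp add: add_pos_nonneg)
      then have "u x / sqrt (1 + (u x)\<^sup>2) ^ 3 \<le> u x / sqrt (d + (u x)\<^sup>2) ^ 3"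
        using d elim by (intro divide_left_mono power_mono mult_pos_pos zero_less_power) (auto simp: add_pos_nonneg)
      then show ?case by (intro mult_right_mono) auto
    qed
  qed (use weighted_gradient_integrable d in auto)
  moreover have "(\<integral>x. \<rho> x * u x * (1 / sqrt (d + (u x)\<^sup>2)) \<partial>lebesgue_on \<Omega>) \<le> (\<integral>x. \<rho> x \<partial>lebesgue_on \<Omega>)"
  proof (rule integral_mono_AE)
    show "integrable (lebesgue_on \<Omega>) (\<lambda>x. \<rho> x * u x * (1 / sqrt (d + (u x)\<^sup>2)))"
      by (rule integrable_mult_bounded[OF \<rho>u _ inverse_sqrt(3)[OF d(1)]]) measurable
    show "AE x in lebesgue_on \<Omega>. \<rho> x * u x * (1 / sqrt (d + (u x)\<^sup>2)) \<le> \<rho> x"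
    proof (rule AE_I2)
      fix x assume "x \<in> space (lebesgue_on \<Omega>)"
      then have "0 \<le> \<rho> x" using \<rho> by (simp add: density_on_def)
      from mult_left_mono[OF inverse_sqrt(5)[OF d(1), of "u x"] this]
      show "\<rho> x * u x * (1 / sqrt (d + (u x)\<^sup>2)) \<le> \<rho> x" by simp
    qed
  qed (use \<rho> in \<open>auto simp: density_on_def\<close>)
  then have "\<kappa> * (\<integral>x. \<rho> x * u x * (1 / sqrt (d + (u x)\<^sup>2)) \<partial>lebesgue_on \<Omega>) \<le> \<kappa>"
    using \<rho> \<kappa>_pos by (simp add: density_on_def mult_left_le)
  ultimately show ?thesis by simp
qed

text \<open>As d decreases to 0 the integrands increase, and their integrals stay bounded, so the
  supremum is finite almost everywhere. At a zero of u it would be infinite since M > 0; this gives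
  u > 0 without a maximum principle. Positivity has to come first, as \<open>M x / 0\<close> is 0 by
  convention and would not be the limit.\<close>

lemma M_div_u:
  shows u_pos: "AE x in lebesgue_on \<Omega>. 0 < u x"
    and M_div_u_integrable: "integrable (lebesgue_on \<Omega>) (\<lambda>x. M x / u x)"
    and M_div_u_bound: "(\<integral>x. M x / u x \<partial>lebesgue_on \<Omega>) \<le> \<kappa> - dissipation"
proof -
  define d where "d n = 1 / real (Suc n)" for n
  have d: "0 < d n" "d n \<le> 1" "d (Suc n) \<le> d n" for n by (auto simp: d_def frac_le)
  define f where "f n x = M x / sqrt (d n + (u x)\<^sup>2)" for n x
  have [measurable]: "f n \<in> borel_measurable (lebesgue_on \<Omega>)" for n unfolding f_def by measurable
  have f_int: "integrable (lebesgue_on \<Omega>) (f n)" for n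
  proof -
    have "integrable (lebesgue_on \<Omega>) (\<lambda>x. M x * (1 / sqrt (d n + (u x)\<^sup>2)))"
      using M_integrable by (rule integrable_mult_bounded[OF _ _ inverse_sqrt(3)[OF d(1)]]) auto
    then show ?thesis by (simp add: f_def[abs_def])
  qed
  have f_nonneg: "0 \<le> f n x" if "x \<in> \<Omega>" for n x
    using M_pos[OF that] d(1)[of n] by (simp add: f_def)
  have le: "(\<integral>\<^sup>+x. ennreal (f n x) \<partial>lebesgue_on \<Omega>) \<le> ennreal (\<kappa> - dissipation)" for n
    using regularized_bound[OF d(1,2)[of n]] f_int[of n] f_nonneg
    by (subst nn_integral_eq_integral) (auto simp: f_def[abs_def] intro!: ennreal_leI)
  have mono: "f n x \<le> f (Suc n) x" if "x \<in> \<Omega>" for n x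
  proof -
    have "0 < d n + (u x)\<^sup>2" "0 < d (Suc n) + (u x)\<^sup>2" using d(1) by (auto simp: add_pos_nonneg)
    then show ?thesis
      unfolding f_def using M_pos[OF that] d(3)[of n] by (intro divide_left_mono) auto
  qed
  have "(\<integral>\<^sup>+x. (SUP n. ennreal (f n x)) \<partial>lebesgue_on \<Omega>) = (SUP n. \<integral>\<^sup>+x. ennreal (f n x) \<partial>lebesgue_on \<Omega>)"
    by (rule nn_integral_monotone_convergence_SUP_AE) (auto intro!: AE_I2 ennreal_leI mono)
  also have "\<dots> \<le> ennreal (\<kappa> - dissipation)" by (rule SUP_least) (rule le)
  finally have sup: "(\<integral>\<^sup>+x. (SUP n. ennreal (f n x)) \<partial>lebesgue_on \<Omega>) \<le> ennreal (\<kappa> - dissipation)" .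
  have fin: "AE x in lebesgue_on \<Omega>. (SUP n. ennreal (f n x)) \<noteq> \<infinity>"
    by (rule nn_integral_noteq_infinite) (use sup in \<open>auto simp: top_unique\<close>)
  moreover have "AE x in lebesgue_on \<Omega>. x \<in> \<Omega>" by (rule AE_I2) simp
  ultimately show pos: "AE x in lebesgue_on \<Omega>. 0 < u x"
    using u_nonneg
  proof eventually_elim
    case (elim x)
    show ?case
    proof (rule ccontr)
      assume "\<not> 0 < u x"
      then have u0: "u x = 0" using elim by simp
      obtain B where B: "(SUP n. ennreal (f n x)) = ennreal B" "0 \<le> B"
        using elim(1) by (metis ennreal_cases infinity_ennreal_def)
      have fB: "f n x \<le> B" for n
      proof -
        have "ennreal (f n x) \<le> ennreal B" unfolding B(1)[symmetric] by (rule SUP_upper) simp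
        then show ?thesis using B(2) by (simp add: ennreal_le_iff)
      qed
      \<comment> \<open>At a zero of u the denominator is sqrt (d n) with d n = 1/(n+1), so the
        sequence is unbounded.\<close>
      have fn: "f n x = M x * sqrt (real (Suc n))" for n
        using u0 by (simp add: f_def d_def real_sqrt_divide)
      obtain n where n: "real n > (B / M x)\<^sup>2" using reals_Archimedean2 by blast
      then have "(B / M x)\<^sup>2 < real (Suc n)" by simp
      then have "B / M x < sqrt (real (Suc n))" by (rule real_less_rsqrt)
      then have "B < M x * sqrt (real (Suc n))"
        using M_pos[of x] elim(2) by (simp add: pos_divide_less_eq mult.commute)
      with fB[of n] fn[of n] show False by simp
    qed
  qed
  have "(\<integral>\<^sup>+x. ennreal (M x / u x) \<partial>lebesgue_on \<Omega>) \<le> (\<integral>\<^sup>+x. (SUP n. ennreal (f n x)) \<partial>lebesgue_on \<Omega>)"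
  proof (rule nn_integral_mono_AE)
    show "AE x in lebesgue_on \<Omega>. ennreal (M x / u x) \<le> (SUP n. ennreal (f n x))"
      using pos
    proof eventually_elim
      case (elim x)
      have "d \<longlonglongrightarrow> 0" using LIMSEQ_Suc[OF lim_1_over_n[where 'a=real]] by (simp add: d_def[abs_def])
      then have "(\<lambda>n. f n x) \<longlonglongrightarrow> M x / sqrt (0 + (u x)\<^sup>2)"
        unfolding f_def using elim by (intro tendsto_intros) auto
      then have "(\<lambda>n. ennreal (f n x)) \<longlonglongrightarrow> ennreal (M x / u x)"
        using elim by (intro tendsto_ennrealI) simp
      then show ?case by (rule LIMSEQ_le_const2) (intro exI allI impI SUP_upper UNIV_I)
    qed
  qed
  with sup have b: "(\<integral>\<^sup>+x. ennreal (M x / u x) \<partial>lebesgue_on \<Omega>) \<le> ennreal (\<kappa> - dissipation)"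
    by (rule order_trans[rotated])
  have nn: "AE x in lebesgue_on \<Omega>. 0 \<le> M x / u x"
    using pos AE_space by eventually_elim (use M_pos in \<open>auto simp: less_imp_le\<close>)
  show i: "integrable (lebesgue_on \<Omega>) (\<lambda>x. M x / u x)"
    using b nn by (intro integrableI_nonneg) (auto intro: le_less_trans)
  \<comment> \<open>\<open>ennreal\<close> truncates negative numbers to 0, so returning to the
    reals needs a nonnegative right side; it dominates the integral of the nonnegative
    \<open>f 0\<close>.\<close>
  have "0 \<le> (\<integral>x. f 0 x \<partial>lebesgue_on \<Omega>)" using f_nonneg by (intro integral_nonneg_AE AE_I2) auto
  then have "0 \<le> \<kappa> - dissipation" using regularized_bound[OF d(1,2)[of 0]] by (simp add: f_def)
  then show "(\<integral>x. M x / u x \<partial>lebesgue_on \<Omega>) \<le> \<kappa> - dissipation"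
    using b nn i by (simp add: nn_integral_eq_integral ennreal_le_iff)
qed

lemma dissipation_nonneg: "0 \<le> dissipation"
  unfolding dissipation_def
  by (rule integral_nonneg_AE) (use u_nonneg in eventually_elim, auto)

text \<open>The weight of the squared gradient is strictly positive because u > 0 almost everywhere;
  mere nonnegativity of u would say nothing about g where u = 0.\<close>

lemma dissipation_zero_imp_gradient_zero:
  assumes "dissipation = 0"
  shows "AE x in lebesgue_on \<Omega>. g x = 0"
proof -
  have nn: "AE x in lebesgue_on \<Omega>. 0 \<le> u x / sqrt (1 + (u x)\<^sup>2) ^ 3 * (norm (g x))\<^sup>2"
    using u_nonneg by eventually_elim auto
  have "AE x in lebesgue_on \<Omega>. u x / sqrt (1 + (u x)\<^sup>2) ^ 3 * (norm (g x))\<^sup>2 = 0"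
    using assms integral_nonneg_eq_0_iff_AE[OF weighted_gradient_integrable[of 1] nn]
    by (simp add: dissipation_def)
  then show ?thesis
    using u_pos
  proof eventually_elim
    case (elim x)
    have "sqrt (1 + (u x)\<^sup>2) > 0" by (simp add: add_pos_nonneg)
    then show ?case using elim by auto
  qed
qed

text \<open>Test with the constant 1, admissible because test functions may be nonzero on the
  boundary: the total absorption equals the total source.\<close>

lemma mass_balance: "\<kappa> * (\<integral>x. \<rho> x * u x \<partial>lebesgue_on \<Omega>) = (\<integral>x. M x \<partial>lebesgue_on \<Omega>)"
  using weak[OF H1_const[OF open_\<Omega> bounded_\<Omega>, of 1], of 1] by simp

text \<open>With zero gradient the weak equation says that
  \<open>\<kappa> * c * \<rho> x - M x\<close> integrates to 0 against every test function, so the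
  fundamental lemma applies.\<close>

lemma constant_solution:
  assumes g0: "AE x in lebesgue_on \<Omega>. g x = 0" and c: "AE x in lebesgue_on \<Omega>. u x = c"
  shows "AE x in lebesgue_on \<Omega>. \<kappa> * c * \<rho> x = M x"
proof -
  let ?f = "\<lambda>x. \<kappa> * c * \<rho> x - M x"
  have i\<rho>: "integrable (lebesgue_on \<Omega>) \<rho>" using \<rho> by (simp add: density_on_def)
  have i: "integrable (lebesgue_on \<Omega>) ?f" using i\<rho> M_integrable by auto
  obtain f0 where f0: "f0 \<in> borel_measurable borel" "\<And>x. x \<notin> \<Omega> \<Longrightarrow> f0 x = 0"
    "AE x in lborel. x \<in> \<Omega> \<longrightarrow> ?f x = f0 x"
    using lebesgue_on_borel_version_exists[OF open_\<Omega> borel_measurable_integrable[OF i]] by metis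
  have "AE x in lborel. x \<in> \<Omega> \<longrightarrow> f0 x = 0"
  proof (rule test_function_integral_zero_imp_AE_zero[OF open_\<Omega>])
    show "integrable lborel f0"
      using integral_lebesgue_on_borel_version(2)[OF open_\<Omega> borel_measurable_integrable[OF i] f0] i by simp
    fix \<phi> :: "'a \<Rightarrow> real" assume \<phi>: "test_function \<Omega> \<phi>"
    note t = test_function_facts[OF \<phi>]
    note facts = smooth_compact_support_facts[OF t(1,2)]
    have \<phi>b: "\<phi> \<in> borel_measurable borel" by (rule facts)
    have [measurable]: "\<phi> \<in> borel_measurable (lebesgue_on \<Omega>)"
      by (intro measurable_restrict_space1 measurable_completion) (use \<phi>b in simp)
    obtain P where P: "\<And>x. \<bar>\<phi> x\<bar> \<le> P" using facts(5) by blast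
    obtain h where h: "H1_on \<Omega> \<phi> h" using H1_test_function[OF open_\<Omega> bounded_\<Omega> \<phi>] by blast
    have "(\<integral>x. g x \<bullet> h x \<partial>lebesgue_on \<Omega>) = 0"
      by (rule integral_eq_zero_AE) (use g0 in eventually_elim, simp)
    moreover have "(\<integral>x. \<rho> x * u x * \<phi> x \<partial>lebesgue_on \<Omega>) = (\<integral>x. c * (\<rho> x * \<phi> x) \<partial>lebesgue_on \<Omega>)"
      by (rule integral_cong_AE) (measurable, use c in eventually_elim, simp)
    moreover have "(\<integral>x. g x \<bullet> h x \<partial>lebesgue_on \<Omega>) + \<kappa> * (\<integral>x. \<rho> x * u x * \<phi> x \<partial>lebesgue_on \<Omega>)
        = (\<integral>x. M x * \<phi> x \<partial>lebesgue_on \<Omega>)"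
      by (rule weak[OF h, of P]) (use P in simp)
    ultimately have "\<kappa> * c * (\<integral>x. \<rho> x * \<phi> x \<partial>lebesgue_on \<Omega>) = (\<integral>x. M x * \<phi> x \<partial>lebesgue_on \<Omega>)"
      by simp
    moreover have "integrable (lebesgue_on \<Omega>) (\<lambda>x. \<rho> x * \<phi> x)" "integrable (lebesgue_on \<Omega>) (\<lambda>x. M x * \<phi> x)"
      using i\<rho> M_integrable P by (auto intro!: integrable_mult_bounded)
    ultimately have "(\<integral>x. ?f x * \<phi> x \<partial>lebesgue_on \<Omega>) = 0"
      by (simp add: left_diff_distrib mult.assoc)
    moreover have "(\<integral>x. ?f x * \<phi> x \<partial>lebesgue_on \<Omega>) = (\<integral>x. f0 x * \<phi> x \<partial>lborel)"
    proof (rule integral_lebesgue_on_borel_version(1)[OF open_\<Omega>])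
      show "AE x in lborel. x \<in> \<Omega> \<longrightarrow> ?f x * \<phi> x = f0 x * \<phi> x"
        using f0(3) by eventually_elim simp
    qed (use f0 \<phi>b in auto)
    ultimately show "(\<integral>x. f0 x * \<phi> x \<partial>lborel) = 0" by simp
  qed
  with f0(3) have "AE x in lborel. x \<in> \<Omega> \<longrightarrow> \<kappa> * c * \<rho> x = M x"
    by eventually_elim auto
  then show ?thesis using AE_lebesgue_on_iff[OF open_\<Omega>, of "\<lambda>x. \<kappa> * c * \<rho> x = M x"] by simp
qed

text \<open>Integrability is the inequality of arithmetic and geometric means. Positivity, which
  permits division by this integral in \<open>passage_time_bound\<close>, holds since M > 0 and
  \<omega> has mass 1.\<close>

lemma sqrt_integral_pos:
  assumes \<omega>: "density_on \<Omega> \<omega>"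
  shows "integrable (lebesgue_on \<Omega>) (\<lambda>x. sqrt (\<omega> x * M x))"
    and "0 < (\<integral>x. sqrt (\<omega> x * M x) \<partial>lebesgue_on \<Omega>)"
proof -
  have i\<omega>: "integrable (lebesgue_on \<Omega>) \<omega>" and \<omega>0: "\<And>x. x \<in> \<Omega> \<Longrightarrow> 0 \<le> \<omega> x"
    and \<omega>1: "(\<integral>x. \<omega> x \<partial>lebesgue_on \<Omega>) = 1"
    using \<omega> by (auto simp: density_on_def)
  have [measurable]: "\<omega> \<in> borel_measurable (lebesgue_on \<Omega>)" using i\<omega> by auto
  show i: "integrable (lebesgue_on \<Omega>) (\<lambda>x. sqrt (\<omega> x * M x))"
  proof (rule Bochner_Integration.integrable_bound)
    show "integrable (lebesgue_on \<Omega>) (\<lambda>x. (\<omega> x + M x) / 2)" using i\<omega> M_integrable by auto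
    show "AE x in lebesgue_on \<Omega>. norm (sqrt (\<omega> x * M x)) \<le> norm ((\<omega> x + M x) / 2)"
    proof (rule AE_I2)
      fix x assume "x \<in> space (lebesgue_on \<Omega>)"
      then have "0 \<le> \<omega> x" "0 \<le> M x" using \<omega>0 M_pos[of x] by auto
      then show "norm (sqrt (\<omega> x * M x)) \<le> norm ((\<omega> x + M x) / 2)"
        using arith_geo_mean_sqrt[of "\<omega> x" "M x"] by simp
    qed
  qed auto
  have nn: "AE x in lebesgue_on \<Omega>. 0 \<le> sqrt (\<omega> x * M x)"
    using \<omega>0 M_pos by (intro AE_I2) (auto simp: less_imp_le)
  have "(\<integral>x. sqrt (\<omega> x * M x) \<partial>lebesgue_on \<Omega>) \<noteq> 0"
  proof
    assume "(\<integral>x. sqrt (\<omega> x * M x) \<partial>lebesgue_on \<Omega>) = 0"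
    then have "AE x in lebesgue_on \<Omega>. sqrt (\<omega> x * M x) = 0"
      using integral_nonneg_eq_0_iff_AE[OF i nn] by simp
    then have "AE x in lebesgue_on \<Omega>. \<omega> x = 0"
      using AE_space by eventually_elim (use M_pos in fastforce)
    then have "(\<integral>x. \<omega> x \<partial>lebesgue_on \<Omega>) = 0" by (rule integral_eq_zero_AE)
    with \<omega>1 show False by simp
  qed
  with integral_nonneg_AE[OF nn] show "0 < (\<integral>x. sqrt (\<omega> x * M x) \<partial>lebesgue_on \<Omega>)" by simp
qed

text \<open>Cauchy-Schwarz in the form of a weighted arithmetic-geometric mean, 2 sqrt(\<omega> M)
  \<le> t \<omega> u + (M/u)/t. Being linear in the integral of M/u, it passes the defect on as the
  factor \<open>1 + dissipation / \<kappa>\<close>, so equality in the main bound leaves no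
  dissipation.\<close>

lemma passage_time_bound:
  assumes \<omega>: "density_on \<Omega> \<omega>" and i: "integrable (lebesgue_on \<Omega>) (\<lambda>x. \<omega> x * u x)"
  defines "S \<equiv> \<integral>x. sqrt (\<omega> x * M x) \<partial>lebesgue_on \<Omega>"
  shows "S\<^sup>2 * (1 + dissipation / \<kappa>) \<le> \<kappa> * (\<integral>x. \<omega> x * u x \<partial>lebesgue_on \<Omega>)"
proof -
  have S: "0 < S" unfolding S_def by (rule sqrt_integral_pos(2)[OF \<omega>])
  \<comment> \<open>The weight that is optimal in the case of equality, where the integral of M/u is
    \<kappa> and that of \<omega> u is S^2 / \<kappa>.\<close>
  define t where "t = \<kappa> / S"
  have t: "0 < t" using S \<kappa>_pos by (simp add: t_def)
  have i2: "integrable (lebesgue_on \<Omega>) (\<lambda>x. t * (\<omega> x * u x) + (M x / u x) / t)"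
    by (intro Bochner_Integration.integrable_add integrable_mult_right integrable_divide i M_div_u_integrable)
  have "2 * S = (\<integral>x. 2 * sqrt (\<omega> x * M x) \<partial>lebesgue_on \<Omega>)" by (simp add: S_def)
  also have "\<dots> \<le> (\<integral>x. t * (\<omega> x * u x) + (M x / u x) / t \<partial>lebesgue_on \<Omega>)"
  proof (rule integral_mono_AE)
    show "AE x in lebesgue_on \<Omega>. 2 * sqrt (\<omega> x * M x) \<le> t * (\<omega> x * u x) + (M x / u x) / t"
      using u_pos AE_space
    proof eventually_elim
      case (elim x)
      have "0 \<le> \<omega> x" "0 \<le> M x" using elim(2) \<omega> M_pos[of x] by (auto simp: density_on_def less_imp_le)
      then have "sqrt ((t * (\<omega> x * u x)) * ((M x / u x) / t)) \<le> (t * (\<omega> x * u x) + (M x / u x) / t) / 2"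
        using elim(1) t by (intro arith_geo_mean_sqrt) auto
      moreover have "(t * (\<omega> x * u x)) * ((M x / u x) / t) = \<omega> x * M x" using elim(1) t by simp
      ultimately show ?case by simp
    qed
  qed (use i2 sqrt_integral_pos(1)[OF \<omega>] in auto)
  also have "\<dots> = t * (\<integral>x. \<omega> x * u x \<partial>lebesgue_on \<Omega>) + (\<integral>x. M x / u x \<partial>lebesgue_on \<Omega>) / t"
    using i M_div_u_integrable
    by (subst Bochner_Integration.integral_add) (auto simp del: divide_divide_eq_left)
  also have "\<dots> \<le> t * (\<integral>x. \<omega> x * u x \<partial>lebesgue_on \<Omega>) + (\<kappa> - dissipation) / t"
    using M_div_u_bound t by (simp add: divide_right_mono)
  finally have "2 * S \<le> (\<kappa> / S) * (\<integral>x. \<omega> x * u x \<partial>lebesgue_on \<Omega>) + (\<kappa> - dissipation) * S / \<kappa>"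
    by (simp add: t_def)
  then have "S * (2 * S) \<le> S * ((\<kappa> / S) * (\<integral>x. \<omega> x * u x \<partial>lebesgue_on \<Omega>) + (\<kappa> - dissipation) * S / \<kappa>)"
    using S by (intro mult_left_mono) auto
  also have "\<dots> = \<kappa> * (\<integral>x. \<omega> x * u x \<partial>lebesgue_on \<Omega>) + S\<^sup>2 - S\<^sup>2 * (dissipation / \<kappa>)"
    using S \<kappa>_pos by (simp add: field_simps power2_eq_square)
  finally show ?thesis by (simp add: power2_eq_square algebra_simps)
qed

lemma mass_pos: "0 < (\<integral>x. M x \<partial>lebesgue_on \<Omega>)"
proof -
  have nn: "AE x in lebesgue_on \<Omega>. 0 \<le> M x" using M_pos by (intro AE_I2) (auto simp: less_imp_le)
  have "(\<integral>x. M x \<partial>lebesgue_on \<Omega>) \<noteq> 0"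
  proof
    assume "(\<integral>x. M x \<partial>lebesgue_on \<Omega>) = 0"
    then have "AE x in lebesgue_on \<Omega>. M x = 0"
      using integral_nonneg_eq_0_iff_AE[OF M_integrable nn] by simp
    \<comment> \<open>As M > 0 everywhere on \<Omega>, its vanishing almost everywhere makes
      \<Omega> a null set, which contradicts the unit mass of \<rho>.\<close>
    then have "AE x in lebesgue_on \<Omega>. \<rho> x = 0"
      using AE_space by eventually_elim (use M_pos in fastforce)
    then have "(\<integral>x. \<rho> x \<partial>lebesgue_on \<Omega>) = 0" by (rule integral_eq_zero_AE)
    then show False using \<rho> by (simp add: density_on_def)
  qed
  with integral_nonneg_AE[OF nn] show ?thesis by simp
qed

text \<open>The gradient vanishes, so u is some constant; its value is found by integrating the
  pointwise equation of \<open>constant_solution\<close>, as \<rho> has mass 1.\<close>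

lemma dissipation_zero_imp_constant:
  assumes "connected \<Omega>" and "dissipation = 0"
  defines "c \<equiv> (\<integral>x. M x \<partial>lebesgue_on \<Omega>) / \<kappa>"
  shows "AE x in lebesgue_on \<Omega>. u x = c" and "AE x in lebesgue_on \<Omega>. \<rho> x = M x / (\<integral>x. M x \<partial>lebesgue_on \<Omega>)"
proof -
  have g0: "AE x in lebesgue_on \<Omega>. g x = 0"
    by (rule dissipation_zero_imp_gradient_zero) fact
  obtain c' where c': "AE x in lebesgue_on \<Omega>. u x = c'"
    by (rule H1_gradient_zero_imp_const[OF open_\<Omega> bounded_\<Omega> assms(1) H1 g0])
  have eq: "AE x in lebesgue_on \<Omega>. \<kappa> * c' * \<rho> x = M x"
    by (rule constant_solution[OF g0 c'])
  have "(\<integral>x. M x \<partial>lebesgue_on \<Omega>) = (\<integral>x. \<kappa> * c' * \<rho> x \<partial>lebesgue_on \<Omega>)"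
    by (rule integral_cong_AE) (measurable, use eq in eventually_elim, simp)
  also have "\<dots> = \<kappa> * c'" using \<rho> by (simp add: density_on_def)
  finally have m: "(\<integral>x. M x \<partial>lebesgue_on \<Omega>) = \<kappa> * c'" .
  then have "c' = c" using \<kappa>_pos by (simp add: c_def)
  with c' show "AE x in lebesgue_on \<Omega>. u x = c" by simp
  show "AE x in lebesgue_on \<Omega>. \<rho> x = M x / (\<integral>x. M x \<partial>lebesgue_on \<Omega>)"
    using eq
  proof eventually_elim
    case (elim x)
    have "\<kappa> * c' \<noteq> 0" using mass_pos unfolding m by (rule less_imp_neq[THEN not_sym])
    then show ?case unfolding m elim[symmetric] by simp
  qed
qed

end

section \<open>The lower bound and its equality case\<close>

theorem theorem1p3:
  fixes \<Omega> :: "'a::euclidean_space set"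
    and D M \<mu> \<omega> \<rho> u :: "'a \<Rightarrow> real"
    and \<kappa> mass :: real
  assumes dim: "DIM('a) \<in> {2, 3}"
    and domain: "smooth_bounded_domain \<Omega>"
    and D_smooth: "smooth_on \<Omega> D"
    and D_pos: "\<And>x. x \<in> \<Omega> \<Longrightarrow> 0 < D x"
    and M_eq: "\<And>x. x \<in> \<Omega> \<Longrightarrow> M x = 1 / D x"
    and M_integrable: "integrable (lebesgue_on \<Omega>) M"
    and mass_eq: "mass = (\<integral>x. M x \<partial>lebesgue_on \<Omega>)"
    and \<mu>_eq: "\<And>x. x \<in> \<Omega> \<Longrightarrow> \<mu> x = M x / mass"
    and \<kappa>_pos: "0 < \<kappa>"
    and \<omega>_density: "density_on \<Omega> \<omega>"
    and \<rho>_density: "density_on \<Omega> \<rho>"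
    and u_solution: "weak_neumann_solution \<Omega> \<kappa> \<rho> M u"
  shows "mean_passage_time \<Omega> \<omega> u \<ge>
           ereal (mass / \<kappa> * (\<integral>x. sqrt (\<omega> x * \<mu> x) \<partial>lebesgue_on \<Omega>)\<^sup>2)
       \<and> (mean_passage_time \<Omega> \<omega> u =
           ereal (mass / \<kappa> * (\<integral>x. sqrt (\<omega> x * \<mu> x) \<partial>lebesgue_on \<Omega>)\<^sup>2)
          \<longleftrightarrow> (AE x in lebesgue_on \<Omega>. \<omega> x = \<mu> x) \<and> (AE x in lebesgue_on \<Omega>. \<rho> x = \<mu> x))"
proof -
  obtain g where g: "H1_on \<Omega> u g" "integrable (lebesgue_on \<Omega>) (\<lambda>x. \<rho> x * u x)"
    "\<And>v h. H1_on \<Omega> v h \<Longrightarrow> (\<exists>C. AE x in lebesgue_on \<Omega>. \<bar>v x\<bar> \<le> C) \<Longrightarrow>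
      (\<integral>x. g x \<bullet> h x \<partial>lebesgue_on \<Omega>) + \<kappa> * (\<integral>x. \<rho> x * u x * v x \<partial>lebesgue_on \<Omega>) =
      (\<integral>x. M x * v x \<partial>lebesgue_on \<Omega>)"
    using u_solution unfolding weak_neumann_solution_def by blast
  have \<Omega>: "open \<Omega>" "bounded \<Omega>" "connected \<Omega>"
    using domain by (auto simp: smooth_bounded_domain_def)
  interpret neumann_solution \<Omega> \<kappa> \<rho> M u g
    using \<Omega> M_integrable \<kappa>_pos \<rho>_density g D_pos M_eq by unfold_locales auto
  let ?N = "lebesgue_on \<Omega>"
  \<comment> \<open>S has M in the place of \<mu>. It differs from T by the factor sqrt mass, which
    turns the claimed bound \<open>mass / \<kappa> * T\<^sup>2\<close> into
    \<open>S\<^sup>2 / \<kappa>\<close>.\<close>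
  define S where "S = (\<integral>x. sqrt (\<omega> x * M x) \<partial>?N)"
  define T where "T = (\<integral>x. sqrt (\<omega> x * \<mu> x) \<partial>?N)"
  have mass: "0 < mass" using mass_pos by (simp add: mass_eq)
  have sqrt_\<mu>: "sqrt (\<omega> x * \<mu> x) = sqrt (\<omega> x * M x) / sqrt mass" if "x \<in> \<Omega>" for x
    using \<mu>_eq[OF that] by (simp add: real_sqrt_divide)
  have "T = (\<integral>x. sqrt (\<omega> x * M x) / sqrt mass \<partial>?N)"
    unfolding T_def by (rule Bochner_Integration.integral_cong) (auto simp: sqrt_\<mu>)
  then have T: "T = S / sqrt mass" by (simp add: S_def)
  have S: "0 < S" unfolding S_def by (rule sqrt_integral_pos(2)[OF \<omega>_density])
  have bound_eq: "mass / \<kappa> * T\<^sup>2 = S\<^sup>2 / \<kappa>"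
    using mass by (simp add: T power_divide)
  have i\<mu>: "integrable ?N \<mu> \<longleftrightarrow> integrable ?N (\<lambda>x. M x / mass)"
    by (rule Bochner_Integration.integrable_cong) (auto simp: \<mu>_eq)
  have "(\<integral>x. \<mu> x \<partial>?N) = (\<integral>x. M x / mass \<partial>?N)"
    by (rule Bochner_Integration.integral_cong) (auto simp: \<mu>_eq)
  then have \<mu>_density: "density_on \<Omega> \<mu>"
    using i\<mu> M_integrable mass M_pos
    by (auto simp: density_on_def \<mu>_eq less_imp_le simp flip: mass_eq)
  have [measurable]: "\<omega> \<in> borel_measurable ?N" "\<mu> \<in> borel_measurable ?N"
    using \<omega>_density \<mu>_density by (auto simp: density_on_def)
  have \<omega>u_nonneg: "AE x in ?N. 0 \<le> \<omega> x * u x"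
    using u_nonneg AE_space by eventually_elim (use \<omega>_density in \<open>auto simp: density_on_def\<close>)
  have "mean_passage_time \<Omega> \<omega> u \<ge> ereal (mass / \<kappa> * T\<^sup>2)
       \<and> (mean_passage_time \<Omega> \<omega> u = ereal (mass / \<kappa> * T\<^sup>2)
          \<longleftrightarrow> (AE x in ?N. \<omega> x = \<mu> x) \<and> (AE x in ?N. \<rho> x = \<mu> x))"
  proof (cases "integrable ?N (\<lambda>x. \<omega> x * u x)")
    case True
    define J where "J = (\<integral>x. \<omega> x * u x \<partial>?N)"
    have mpt: "mean_passage_time \<Omega> \<omega> u = ereal J"
      unfolding J_def by (rule mean_passage_time_eq_integral[OF True])
    have bound: "S\<^sup>2 * (1 + dissipation / \<kappa>) \<le> \<kappa> * J"
      unfolding J_def S_def by (rule passage_time_bound[OF \<omega>_density True])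
    have "0 \<le> S\<^sup>2 * (dissipation / \<kappa>)" using dissipation_nonneg \<kappa>_pos by simp
    then have "S\<^sup>2 \<le> \<kappa> * J" using bound by (simp add: distrib_left)
    then have le: "S\<^sup>2 / \<kappa> \<le> J" using \<kappa>_pos by (simp add: divide_le_eq mult.commute)
    have "J = S\<^sup>2 / \<kappa> \<longleftrightarrow> (AE x in ?N. \<omega> x = \<mu> x) \<and> (AE x in ?N. \<rho> x = \<mu> x)"
    proof
      assume J: "J = S\<^sup>2 / \<kappa>"
      then have "\<kappa> * J = S\<^sup>2" using \<kappa>_pos by simp
      then have "S\<^sup>2 * (dissipation / \<kappa>) \<le> 0" using bound by (simp add: distrib_left)
      then have "dissipation = 0"
        using S \<kappa>_pos dissipation_nonneg by (auto simp: mult_le_0_iff divide_le_0_iff)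
      note const = dissipation_zero_imp_constant[OF \<Omega>(3) this, folded mass_eq]
      \<comment> \<open>With u equal to mass / \<kappa> and \<omega> of mass 1, J is mass /
        \<kappa>; comparing with S^2 / \<kappa> gives T = 1, the case settled by
        \<open>density_eq_of_sqrt_integral\<close>.\<close>
      have "J = (\<integral>x. \<omega> x * (mass / \<kappa>) \<partial>?N)"
        unfolding J_def by (rule integral_cong_AE) (measurable, use const(1) in eventually_elim, simp)
      also have "\<dots> = mass / \<kappa>" using \<omega>_density by (simp add: density_on_def)
      finally have "S\<^sup>2 = mass" using J \<kappa>_pos by simp
      then have "T = 1" using S by (simp add: T flip: \<open>S\<^sup>2 = mass\<close>)
      moreover have "integrable ?N (\<lambda>x. sqrt (\<omega> x * \<mu> x)) \<longleftrightarrow> integrable ?N (\<lambda>x. sqrt (\<omega> x * M x) / sqrt mass)"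
        by (rule Bochner_Integration.integrable_cong) (auto simp: sqrt_\<mu>)
      ultimately have "AE x in ?N. \<omega> x = \<mu> x"
        using density_eq_of_sqrt_integral[OF \<omega>_density \<mu>_density] sqrt_integral_pos(1)[OF \<omega>_density]
        by (simp add: T_def)
      moreover have "AE x in ?N. \<rho> x = \<mu> x"
        using const(2) AE_space by eventually_elim (simp add: \<mu>_eq)
      ultimately show "(AE x in ?N. \<omega> x = \<mu> x) \<and> (AE x in ?N. \<rho> x = \<mu> x)" ..
    next
      assume "(AE x in ?N. \<omega> x = \<mu> x) \<and> (AE x in ?N. \<rho> x = \<mu> x)"
      then have \<omega>: "AE x in ?N. \<omega> x = \<mu> x" and \<rho>\<mu>: "AE x in ?N. \<rho> x = \<mu> x" by auto
      \<comment> \<open>With \<rho> in the place of \<omega>, \<kappa> times the mean is the total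
        absorption, whose value \<open>mass_balance\<close> gives directly.\<close>
      have "J = (\<integral>x. \<rho> x * u x \<partial>?N)"
        unfolding J_def by (rule integral_cong_AE) (measurable, use \<omega> \<rho>\<mu> in eventually_elim, simp)
      then have J: "\<kappa> * J = mass" using mass_balance by (simp add: mass_eq)
      have "T = (\<integral>x. \<mu> x \<partial>?N)"
        unfolding T_def
      proof (rule integral_cong_AE)
        show "AE x in ?N. sqrt (\<omega> x * \<mu> x) = \<mu> x"
          using \<omega> AE_space by eventually_elim (use \<mu>_density in \<open>auto simp: density_on_def\<close>)
      qed measurable
      then have "T = 1" using \<mu>_density by (simp add: density_on_def)
      then show "J = S\<^sup>2 / \<kappa>"
        using J bound_eq \<kappa>_pos by (simp add: field_simps)
    qed
    then show ?thesis using le unfolding mpt bound_eq by simp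
  next
    case False
    have "mean_passage_time \<Omega> \<omega> u = \<infinity>"
      by (rule mean_passage_time_eq_infinity[OF _ \<omega>u_nonneg False]) measurable
    \<comment> \<open>The mean is infinite, so equality fails and the densities must not both be
      \<mu>: then \<omega> u would agree with \<rho> u, which is integrable for a weak
      solution.\<close>
    moreover have "\<not> ((AE x in ?N. \<omega> x = \<mu> x) \<and> (AE x in ?N. \<rho> x = \<mu> x))"
    proof
      assume "(AE x in ?N. \<omega> x = \<mu> x) \<and> (AE x in ?N. \<rho> x = \<mu> x)"
      then have "AE x in ?N. \<omega> x = \<mu> x" "AE x in ?N. \<rho> x = \<mu> x" by auto
      then have "AE x in ?N. \<rho> x * u x = \<omega> x * u x" by eventually_elim simp
      then have "integrable ?N (\<lambda>x. \<omega> x * u x)"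
        using \<rho>u by (subst (asm) integrable_cong_AE) auto
      with False show False by simp
    qed
    ultimately show ?thesis by auto
  qed
  then show ?thesis by (simp add: T_def)
qed

end
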